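(* Let $b=b(n)\ge 1$ be an integer-valued function that is subpolynomial in $n$. Then, as $n\to\infty$, $$\tau(\mathcal{HAM}_n,b)=(1+o(1))\log_{b+1}(n),$$ where $\mathcal{HAM}_n$ is the hypergraph with vertex set $E(K_n)$ whose hyperedges are the edge sets of all Hamilton cycles of $K_n$.
   Context: A function $f(n)$ is subpolynomial in $n$ if $f(n)=o(n^{\varepsilon})$ for all $\varepsilon>0$. Multistage $(1:b)$ Maker-Breaker game on a hypergraph $\mathcal{H}=(\mathcal{X},\mathcal{F})$ (board $\mathcal{X}$, family of winning sets $\mathcal{F}$), $b\ge 1$ an integer: Put $\mathcal{X}_0:=\mathcal{X}$, $\mathcal{F}_0:=\mathcal{F}$. For $i\ge 1$, in Stage $i$ Maker and Breaker play on the board $\mathcal{X}_{i-1}$, alternating in turns in which Maker claims exactly one unclaimed element of $\mathcal{X}_{i-1}$ and afterwards Breaker claims up to $b$ unclaimed elements of $\mathcal{X}_{i-1}$, with Maker moving first. Once all elements of $\mathcal{X}_{i-1}$ have been distributed among the players, $\mathcal{X}_i\subseteq\mathcal{X}_{i-1}$ denotes the set of all elements claimed by Maker in Stage $i$, and $\mathcal{F}_i:=\{F\in\mathcal{F}_{i-1}: F\subseteq\mathcal{X}_i\}$. The game stops the first time no winning sets are left. The threshold parameter $\tau(\mathcal{H},b)$ is the largest number $s$ such that Maker has a strategy (against every play of Breaker) ensuring $\mathcal{F}_s\neq\varnothing$. *)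

theory Defs
  imports Complex_Main "HOL-Library.Landau_Symbols"
begin

text \<open>A hypergraph is a pair of a board and a family of winning sets. The game below is
  intended for finite boards.\<close>

type_synonym 'a hypergraph = "'a set \<times> 'a set set"

text \<open>A round \<open>(m, B)\<close> consists of the element \<open>m\<close> claimed by Maker and the set \<open>B\<close> of elements
  claimed by Breaker in reply. A stage is the list of its rounds in chronological order, and a
  position of the game is given by the list of completed stages together with the rounds played
  so far in the current stage. A strategy of Maker may depend on the whole position.\<close>

type_synonym 'a round = "'a \<times> 'a set"
type_synonym 'a stage = "'a round list"
type_synonym 'a strategy = "'a stage list \<Rightarrow> 'a stage \<Rightarrow> 'a"

definition maker_claimed :: "'a stage \<Rightarrow> 'a set" where
  "maker_claimed h = fst ` set h"

definition breaker_claimed :: "'a stage \<Rightarrow> 'a set" where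
  "breaker_claimed h = \<Union> (snd ` set h)"

text \<open>\<open>board X [h\<^sub>1, \<dots>, h\<^sub>i]\<close> is \<open>X\<^sub>i\<close>, and \<open>winning_sets F [h\<^sub>1, \<dots>, h\<^sub>i]\<close> is \<open>F\<^sub>i\<close>.\<close>

fun board :: "'a set \<Rightarrow> 'a stage list \<Rightarrow> 'a set" where
  "board X [] = X"
| "board X (h # hs) = board (maker_claimed h) hs"

fun winning_sets :: "'a set set \<Rightarrow> 'a stage list \<Rightarrow> 'a set set" where
  "winning_sets F [] = F"
| "winning_sets F (h # hs) = winning_sets {W \<in> F. W \<subseteq> maker_claimed h} hs"

definition unclaimed :: "'a set \<Rightarrow> 'a stage list \<Rightarrow> 'a stage \<Rightarrow> 'a set" where
  "unclaimed X hs h = board X hs - maker_claimed h - breaker_claimed h"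

text \<open>The positions that can arise when Maker follows \<open>\<sigma>\<close> and Breaker plays arbitrarily. The rule
  that the game stops once no winning sets are left is not imposed: the sets \<open>F\<^sub>i\<close> are decreasing,
  so that continuing the play has no influence on whether \<open>F\<^sub>s\<close> is nonempty.\<close>

inductive reachable :: "'a set \<Rightarrow> nat \<Rightarrow> 'a strategy \<Rightarrow> 'a stage list \<Rightarrow> 'a stage \<Rightarrow> bool"
  for X :: "'a set" and b :: nat and \<sigma> :: "'a strategy" where
  start: "reachable X b \<sigma> [] []"
| play_round:
    "\<lbrakk>reachable X b \<sigma> hs h; \<sigma> hs h \<in> unclaimed X hs h;
      B \<subseteq> unclaimed X hs h - {\<sigma> hs h}; finite B; card B \<le> b\<rbrakk>
     \<Longrightarrow> reachable X b \<sigma> hs (h @ [(\<sigma> hs h, B)])"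
| finish_stage:
    "\<lbrakk>reachable X b \<sigma> hs h; unclaimed X hs h = {}\<rbrakk> \<Longrightarrow> reachable X b \<sigma> (hs @ [h]) []"

text \<open>Without this legality requirement Maker could avoid losing by making an illegal move,
  as the play is then stuck in \<open>reachable\<close>.\<close>

definition legal_strategy :: "'a set \<Rightarrow> nat \<Rightarrow> 'a strategy \<Rightarrow> bool" where
  "legal_strategy X b \<sigma> \<longleftrightarrow>
     (\<forall>hs h. reachable X b \<sigma> hs h \<longrightarrow> unclaimed X hs h \<noteq> {} \<longrightarrow> \<sigma> hs h \<in> unclaimed X hs h)"

definition maker_can_ensure :: "'a hypergraph \<Rightarrow> nat \<Rightarrow> nat \<Rightarrow> bool" where
  "maker_can_ensure H b s \<longleftrightarrow>
     (\<exists>\<sigma>. legal_strategy (fst H) b \<sigma> \<and>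
          (\<forall>hs h. reachable (fst H) b \<sigma> hs h \<longrightarrow> length hs = s \<longrightarrow> winning_sets (snd H) hs \<noteq> {}))"

text \<open>The largest such \<open>s\<close> need not exist for degenerate hypergraphs, e.g. if there are no winning
  sets at all, or if the board consists of one element and this forms a winning set. In these cases
  the value of \<open>\<tau>\<close> is unspecified.\<close>

definition threshold :: "'a hypergraph \<Rightarrow> nat \<Rightarrow> nat" ("\<tau>") where
  "\<tau> H b = (GREATEST s. maker_can_ensure H b s)"

definition complete_graph_edges :: "nat \<Rightarrow> nat set set" where
  "complete_graph_edges n = {e. e \<subseteq> {..<n} \<and> card e = 2}"

text \<open>A cycle is given by the list of its vertices in cyclic order.\<close>

definition cycle_edges :: "'v list \<Rightarrow> 'v set set" where
  "cycle_edges vs = {{vs ! i, vs ! (Suc i mod length vs)} | i. i < length vs}"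

definition hamilton_cycle :: "'v set \<Rightarrow> 'v set set \<Rightarrow> 'v list \<Rightarrow> bool" where
  "hamilton_cycle V E vs \<longleftrightarrow>
     distinct vs \<and> length vs \<ge> 3 \<and> set vs = V \<and> cycle_edges vs \<subseteq> E"

definition HAM :: "nat \<Rightarrow> nat set hypergraph" where
  "HAM n = (complete_graph_edges n,
            {cycle_edges vs | vs. hamilton_cycle {..<n} (complete_graph_edges n) vs})"

definition subpolynomial :: "(nat \<Rightarrow> real) \<Rightarrow> bool" where
  "subpolynomial f \<longleftrightarrow> (\<forall>\<epsilon>>0. f \<in> o(\<lambda>n. real n powr \<epsilon>))"

end

theory Submission
  imports Defs "HOL-Real_Asymp.Real_Asymp"
begin

text \<open>If Breaker always claims \<open>b\<close> edges, then at most about \<open>n\<^sup>2 / (2 * (b + 1) ^ s)\<close> edges are left after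
  \<open>s\<close> stages, and a Hamilton cycle needs \<open>n\<close> of them; hence \<open>(b + 1) ^ s \<le> n\<close>.

  Conversely, fix \<open>\<theta> > 0\<close> and let \<open>(b + 1) ^ s\<close> be about \<open>n powr (1 - 10 * \<theta>)\<close>. A derandomized random
  strategy lets Maker keep, through all \<open>s\<close> stages, about the proportion \<open>1 / (b + 1)\<close> per stage of
  every set in a prescribed family, provided that the sets are large compared with the logarithm of
  their number. The family consists of two kinds of sets of edges. Those between \<open>A\<close> and the
  complement of \<open>A \<union> B\<close>, where \<open>card B = 2 * card A\<close> and \<open>card A \<le> n / 4\<close>, make the final graph so
  strongly expanding that it has a sparse subgraph \<open>G\<close> in which every such \<open>A\<close> still has more than
  \<open>2 * card A\<close> outer neighbours. The others are the sets of boosters of all sparse expanders, where a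
  booster of a graph is an edge whose addition yields a Hamilton cycle or a longer longest path; by
  Posa's rotation argument an expander has quadratically many of them. The final graph therefore
  contains a booster of \<open>G\<close>, and adding boosters one at a time produces a Hamilton cycle.\<close>

section \<open>Strategies and plays\<close>

lemma board_snoc [simp]: "board X (hs @ [h]) = maker_claimed h"
  by (induction hs arbitrary: X) auto

lemma winning_sets_snoc [simp]:
  "winning_sets F (hs @ [h]) = {W \<in> winning_sets F hs. W \<subseteq> maker_claimed h}"
  by (induction hs arbitrary: F) auto

lemma maker_claimed_Nil [simp]: "maker_claimed [] = {}"
  and maker_claimed_snoc [simp]: "maker_claimed (h @ [(m, B)]) = insert m (maker_claimed h)"
  by (auto simp: maker_claimed_def)

lemma finite_maker_claimed [simp]: "finite (maker_claimed h)"
  by (simp add: maker_claimed_def)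

lemma finite_board: "finite X \<Longrightarrow> finite (board X hs)"
  by (induction hs arbitrary: X) auto

lemma finite_unclaimed: "finite X \<Longrightarrow> finite (unclaimed X hs h)"
  by (simp add: unclaimed_def finite_board)

lemma unclaimed_Nil [simp]: "unclaimed X hs [] = board X hs"
  by (simp add: unclaimed_def breaker_claimed_def)

lemma unclaimed_snoc: "unclaimed X hs (h @ [(m, B)]) = unclaimed X hs h - {m} - B"
  by (auto simp: unclaimed_def breaker_claimed_def)

text \<open>As the boards decrease, the nested filters collapse to the single condition
  \<open>W \<subseteq> board X hs\<close>, so only the last board matters to Maker.\<close>

lemma reachable_winning_sets:
  assumes "reachable X b \<sigma> hs h" and "\<And>W. W \<in> F \<Longrightarrow> W \<subseteq> X"
  shows "winning_sets F hs = {W \<in> F. W \<subseteq> board X hs} \<and> maker_claimed h \<subseteq> board X hs"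
  using assms(1)
proof induction
  case start
  have "{W \<in> F. W \<subseteq> X} = F" using assms(2) by blast
  then show ?case by simp
next
  case (play_round hs h B)
  then show ?case by (simp add: unclaimed_def)
next
  case (finish_stage hs h)
  then have "{W \<in> F. W \<subseteq> board X hs \<and> W \<subseteq> maker_claimed h} = {W \<in> F. W \<subseteq> maker_claimed h}"
    by blast
  with finish_stage show ?case by simp
qed

lemma reachable_board_subset:
  "reachable X b \<sigma> hs h \<Longrightarrow> maker_claimed h \<subseteq> board X hs \<and> board X hs \<subseteq> X"
  by (induction rule: reachable.induct) (auto simp: unclaimed_def)

text \<open>Turns an invariant of positions into a strategy: Maker chooses any move after which
  every legal reply keeps \<open>P\<close>.\<close>

lemma strategy_of_invariant:
  assumes init: "P [] []"
    and step: "\<And>hs h. P hs h \<Longrightarrow> unclaimed X hs h \<noteq> {} \<Longrightarrow>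
      \<exists>m\<in>unclaimed X hs h. \<forall>B. B \<subseteq> unclaimed X hs h - {m} \<longrightarrow> finite B \<longrightarrow> card B \<le> b \<longrightarrow>
        P hs (h @ [(m, B)])"
    and fin: "\<And>hs h. P hs h \<Longrightarrow> unclaimed X hs h = {} \<Longrightarrow> P (hs @ [h]) []"
  obtains \<sigma> where "legal_strategy X b \<sigma>" "\<And>hs h. reachable X b \<sigma> hs h \<Longrightarrow> P hs h"
proof -
  define good where "good hs h m \<longleftrightarrow> m \<in> unclaimed X hs h \<and>
    (\<forall>B. B \<subseteq> unclaimed X hs h - {m} \<longrightarrow> finite B \<longrightarrow> card B \<le> b \<longrightarrow> P hs (h @ [(m, B)]))"
    for hs h m
  define \<sigma> where "\<sigma> hs h = (SOME m. good hs h m)" for hs h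
  have good: "good hs h (\<sigma> hs h)" if "P hs h" "unclaimed X hs h \<noteq> {}" for hs h
  proof -
    have "\<exists>m. good hs h m" using step[OF that] unfolding good_def Bex_def .
    then show ?thesis unfolding \<sigma>_def by (rule someI_ex)
  qed
  have inv: "P hs h" if "reachable X b \<sigma> hs h" for hs h
    using that
  proof induction
    case (play_round hs h B)
    then have "unclaimed X hs h \<noteq> {}" by auto
    with good play_round show ?case unfolding good_def by blast
  qed (use init fin in auto)
  show thesis
  proof
    show "legal_strategy X b \<sigma>"
      unfolding legal_strategy_def using inv good good_def by blast
  qed (use inv in blast)
qed

text \<open>Breaker claims exactly \<open>b\<close> elements in every round, as long as there are enough.\<close>

lemma reachable_full_stage:
  assumes "legal_strategy X b \<sigma>" "finite X" "reachable X b \<sigma> hs h"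
  shows "\<exists>h'. reachable X b \<sigma> hs h' \<and> unclaimed X hs h' = {} \<and>
    (b + 1) * card (maker_claimed h') \<le> (b + 1) * card (maker_claimed h) + card (unclaimed X hs h) + b"
  using assms(3)
proof (induction "card (unclaimed X hs h)" arbitrary: h rule: less_induct)
  case less
  let ?U = "unclaimed X hs h"
  have finU: "finite ?U" using assms(2) by (rule finite_unclaimed)
  show ?case
  proof (cases "?U = {}")
    case True
    with less.prems show ?thesis by (intro exI[of _ h]) simp
  next
    case False
    define m where "m = \<sigma> hs h"
    have m: "m \<in> ?U" using assms(1) less.prems False unfolding legal_strategy_def m_def by blast
    have "min b (card ?U - 1) \<le> card (?U - {m})" using m finU by simp
    then obtain B where B: "B \<subseteq> ?U - {m}" "card B = min b (card ?U - 1)" "finite B"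
      by (rule obtain_subset_with_card_n)
    let ?h = "h @ [(m, B)]"
    have r: "reachable X b \<sigma> hs ?h"
      using play_round[OF less.prems, of B] m B unfolding m_def by simp
    have U': "unclaimed X hs ?h = ?U - {m} - B" by (rule unclaimed_snoc)
    have c1: "card (unclaimed X hs ?h) = card ?U - 1 - min b (card ?U - 1)"
      unfolding U' using m finU B by (simp add: card_Diff_subset)
    have pos: "card ?U > 0" using m finU by (auto simp: card_gt_0_iff)
    have "card (maker_claimed ?h) \<le> card (maker_claimed h) + 1" by (simp add: card_insert_if)
    then have c2: "(b + 1) * card (maker_claimed ?h) \<le> (b + 1) * card (maker_claimed h) + (b + 1)"
      by (metis add_mult_distrib2 mult.right_neutral mult_le_mono2)
    show ?thesis
    proof (cases "b \<le> card ?U - 1")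
      case True
      obtain h' where "reachable X b \<sigma> hs h'" "unclaimed X hs h' = {}"
        "(b + 1) * card (maker_claimed h') \<le> (b + 1) * card (maker_claimed ?h) + card (unclaimed X hs ?h) + b"
        using less.hyps[OF _ r] c1 pos by fastforce
      moreover have "card (unclaimed X hs ?h) + (b + 1) = card ?U" using c1 True pos by simp
      ultimately show ?thesis using c2 by (intro exI[of _ h']) linarith
    next
      case False
      \<comment> \<open>In this last round Maker's element counts \<open>b + 1\<close>, while
        possibly only one unclaimed element disappears; the summand \<open>b\<close> of the claim
        pays for the difference.\<close>
      then have "unclaimed X hs ?h = {}"
        using c1 finite_unclaimed[OF assms(2)] by simp
      with r c2 pos show ?thesis by (intro exI[of _ ?h]) auto
    qed
  qed
qed

lemma reachable_full_stages:
  assumes "legal_strategy X b \<sigma>" "finite X" "b \<ge> 1"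
  shows "\<exists>hs. reachable X b \<sigma> hs [] \<and> length hs = s \<and>
    real (card (board X hs)) \<le> real (card X) / (real b + 1) ^ s + 2"
proof (induction s)
  case 0
  then show ?case using start by (intro exI[of _ "[]"]) auto
next
  case (Suc s)
  then obtain hs where hs: "reachable X b \<sigma> hs []" "length hs = s"
    and le: "real (card (board X hs)) \<le> real (card X) / (real b + 1) ^ s + 2" by blast
  obtain h where h: "reachable X b \<sigma> hs h" "unclaimed X hs h = {}"
    and hle: "(b + 1) * card (maker_claimed h) \<le> card (board X hs) + b"
    using reachable_full_stage[OF assms(1,2) hs(1)] by auto
  from hle have "real ((b + 1) * card (maker_claimed h)) \<le> real (card (board X hs) + b)"
    by (rule of_nat_mono)
  then have "(real b + 1) * real (card (maker_claimed h)) \<le> real (card (board X hs)) + real b"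
    by (simp add: algebra_simps)
  \<comment> \<open>The constant 2 reproduces itself from stage to stage because
    \<open>2 + b \<le> 2 * (b + 1)\<close>.\<close>
  also have "\<dots> \<le> real (card X) / (real b + 1) ^ s + 2 * (real b + 1)" using le assms(3) by simp
  also have "\<dots> = (real b + 1) * (real (card X) / (real b + 1) ^ Suc s + 2)"
    by (simp add: distrib_left add_nonneg_eq_0_iff)
  finally have "real (card (maker_claimed h)) \<le> real (card X) / (real b + 1) ^ Suc s + 2"
    by (rule mult_left_le_imp_le) simp
  with finish_stage[OF h] hs(2) show ?case by (intro exI[of _ "hs @ [h]"]) auto
qed

section \<open>The potential\<close>

text \<open>This is the sum over \<open>i\<close> of the expectation of \<open>(1 - z i) ^ card (A i \<inter> M')\<close> if \<open>M'\<close> arises from \<open>M\<close> by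
  adding every element of \<open>F\<close> independently with probability \<open>p\<close>. For \<open>p\<close> slightly smaller than
  \<open>1 / (b + 1)\<close> Maker can prevent it from growing. With \<open>z\<close> replaced by \<open>p * z\<close> one stage earlier, the
  final value of a stage is the initial value of the next one.\<close>

definition potential :: "real \<Rightarrow> ('i \<Rightarrow> real) \<Rightarrow> 'i set \<Rightarrow> ('i \<Rightarrow> 'a set) \<Rightarrow> 'a set \<Rightarrow> 'a set \<Rightarrow> real" where
  "potential p z I A M F = (\<Sum>i\<in>I. (1 - z i) ^ card (A i \<inter> M) * (1 - p * z i) ^ card (A i \<inter> F))"

lemma potential_rate:
  fixes p \<delta> :: real
  assumes "0 < \<delta>" "\<delta> < 1" "p = (1 - \<delta>) / (real b + 1)"
  shows "0 < p" "p < 1" "real b * p + p = 1 - \<delta>"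
proof -
  show "0 < p" using assms by (simp add: add_nonneg_pos)
  have "p * (real b + 1) = 1 - \<delta>" unfolding assms(3) by (simp add: add_nonneg_eq_0_iff)
  then show eq: "real b * p + p = 1 - \<delta>" by (simp add: algebra_simps)
  have "0 \<le> real b * p" using \<open>0 < p\<close> by simp
  with eq assms(1) show "p < 1" by linarith
qed

text \<open>When Breaker claims \<open>k\<close> elements of a set, its term of the potential is
  divided by \<open>(1 - p * z) ^ k\<close>. The linear bound charges each of them
  \<open>1 / b\<close> of the relative gain \<open>(1 - p) * z\<close> that one element brings to
  Maker. It holds since the true slope is about \<open>p * z\<close>, and \<open>b * p\<close> is
  smaller than \<open>1 - p\<close> by \<open>\<delta>\<close>.\<close>

lemma inverse_power_le_linear:
  fixes p \<delta> z :: real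
  assumes "0 < \<delta>" "\<delta> < 1" "p = (1 - \<delta>) / (real b + 1)" "0 \<le> z" "z \<le> \<delta>" "k \<le> b" "b \<ge> 1"
  shows "1 \<le> (1 + real k * ((1 - p) / real b) * z) * (1 - p * z) ^ k"
proof -
  have p: "0 < p" "p < 1" "real b * p + p = 1 - \<delta>"
    using potential_rate[OF assms(1-3)] by auto
  have bp: "real b * p < 1" "0 < real b * p" using p assms(1,7) by auto
  define \<kappa> where "\<kappa> = (1 - p) / real b"
  have \<kappa>: "\<kappa> * real b = 1 - p" "0 \<le> \<kappa>" using assms(7) p by (auto simp: \<kappa>_def)
  have pz: "0 \<le> p * z" using p assms(4) by simp
  have pz1: "p * z \<le> 1" using p(1,2) assms(2,4,5) by (intro mult_le_one) auto
  have kz: "real k * (p * z) \<le> real b * p * z" using assms(4,6) p(1)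
    by (simp add: mult.assoc mult_right_mono)
  have "real b * p * z \<le> 1 * \<delta>" using bp assms by (intro mult_mono) auto
  then have bpz: "real b * p * z \<le> \<delta>" by simp
  have bern: "1 - real k * (p * z) \<le> (1 - p * z) ^ k"
    using Bernoulli_inequality[of "- (p * z)" k] pz1 by simp
  \<comment> \<open>As \<open>1 - p - b * p = \<delta>\<close>, this says that the second-order term
    is at most \<open>\<delta>\<close>; here \<open>z \<le> \<delta>\<close> enters.\<close>
  have "p * real b \<le> (1 - p) * (1 - real b * p * z)"
  proof -
    have "(1 - p) * (real b * p * z) \<le> 1 * (1 * \<delta>)"
      using p assms bp bpz by (intro mult_mono) auto
    then show ?thesis using p(3) by (simp add: algebra_simps)
  qed
  also have "\<dots> = \<kappa> * (1 - real b * p * z) * real b" using \<kappa> by simp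
  finally have "p \<le> \<kappa> * (1 - real b * p * z)" using assms(7) by simp
  also have "\<dots> \<le> \<kappa> * (1 - real k * (p * z))" using \<kappa> kz by (intro mult_left_mono) auto
  finally have "real k * z * p \<le> real k * z * (\<kappa> * (1 - real k * (p * z)))"
    using assms by (intro mult_left_mono) auto
  then have "1 \<le> (1 + real k * \<kappa> * z) * (1 - real k * (p * z))"
    by (simp add: algebra_simps)
  also have "\<dots> \<le> (1 + real k * \<kappa> * z) * (1 - p * z) ^ k"
    using bern \<kappa> assms by (intro mult_left_mono) auto
  finally show ?thesis by (simp add: \<kappa>_def)
qed

text \<open>When Maker claims an element of a set, one factor \<open>1 - p * z\<close> of its term
  becomes \<open>1 - z\<close>; this quantifies the relative gain as
  \<open>(1 - p) * z\<close>.\<close>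

lemma maker_factor_le:
  fixes p z :: real
  assumes "0 < p" "p < 1" "0 \<le> z" "z \<le> 1"
  shows "1 - z \<le> (1 - (1 - p) * z) * (1 - p * z)"
proof -
  have "(1 - (1 - p) * z) * (1 - p * z) = 1 - z + (1 - p) * p * z * z" by (simp add: algebra_simps)
  then show ?thesis using assms by simp
qed

text \<open>Maker claims the element \<open>m\<close> of largest weight \<open>D m\<close>, which
  gains \<open>(1 - p) * D m\<close>. Each of Breaker's at most \<open>b\<close> elements
  \<open>x\<close> costs at most \<open>(1 - p) / b * D x \<le> (1 - p) / b * D m\<close>, so the
  gain covers the whole reply.\<close>

lemma potential_round:
  fixes A :: "'i \<Rightarrow> 'a set"
  assumes "0 < \<delta>" "\<delta> < 1" "p = (1 - \<delta>) / (real b + 1)" "b \<ge> 1"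
    and "\<And>i. i \<in> I \<Longrightarrow> 0 \<le> z i" "\<And>i. i \<in> I \<Longrightarrow> z i \<le> \<delta>"
    and fin: "finite I" "finite M" "finite F" and ne: "F \<noteq> {}" and disj: "M \<inter> F = {}"
  shows "\<exists>m\<in>F. \<forall>B. B \<subseteq> F - {m} \<longrightarrow> card B \<le> b \<longrightarrow>
    potential p z I A (insert m M) (F - {m} - B) \<le> potential p z I A M F"
proof -
  have p: "0 < p" "p < 1" using potential_rate[OF assms(1-3)] by auto
  define f where "f i = (1 - z i) ^ card (A i \<inter> M) * (1 - p * z i) ^ card (A i \<inter> F)" for i
  define D where "D x = (\<Sum>i\<in>I. if x \<in> A i then f i * z i else 0)" for x
  define \<kappa> where "\<kappa> = (1 - p) / real b"
  have \<kappa>: "\<kappa> * real b = 1 - p" "0 \<le> \<kappa>" using assms(4) p by (auto simp: \<kappa>_def)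
  have pz: "0 \<le> p * z i" "p * z i < 1" if "i \<in> I" for i
  proof -
    have "p * z i \<le> 1 * \<delta>" using assms(1,2) assms(5,6)[OF that] p by (intro mult_mono) auto
    then show "p * z i < 1" using assms(2) by linarith
  qed (use assms(5)[OF that] p in auto)
  have f0: "0 \<le> f i" if "i \<in> I" for i
    using assms(2) assms(5,6)[OF that] pz[OF that] by (simp add: f_def)
  obtain m where m: "m \<in> F" and "Max (D ` F) = D m"
    using obtains_MAX[OF fin(3) ne, of D] by metis
  then have max: "D x \<le> D m" if "x \<in> F" for x
    using that fin(3) by (metis Max_ge finite_imageI imageI)
  have "potential p z I A (insert m M) (F - {m} - B) \<le> potential p z I A M F"
    if B: "B \<subseteq> F - {m}" "card B \<le> b" for B
  proof -
    have finB: "finite B" using B fin(3) finite_subset by blast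
    have "potential p z I A (insert m M) (F - {m} - B)
      \<le> (\<Sum>i\<in>I. f i - (1 - p) * (if m \<in> A i then f i * z i else 0)
          + \<kappa> * (\<Sum>x\<in>B. if x \<in> A i then f i * z i else 0))"
      unfolding potential_def
    proof (rule sum_mono)
      fix i assume i: "i \<in> I"
      define k where "k = card (A i \<inter> B)"
      have kb: "k \<le> b" unfolding k_def using B(2) card_mono[OF finB, of "A i \<inter> B"] by auto
      have ks: "(\<Sum>x\<in>B. if x \<in> A i then f i * z i else 0) = real k * (f i * z i)"
        using finB by (simp add: sum.If_cases k_def Int_commute)
      define c where "c = 1 - p * z i"
      define a where "a = (if m \<in> A i then 1 else 0 :: nat)"
      have c: "0 < c" using pz[OF i] by (simp add: c_def)
      have cM: "card (A i \<inter> insert m M) = card (A i \<inter> M) + a"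
      proof (cases "m \<in> A i")
        case True
        moreover have "m \<notin> A i \<inter> M" using m disj by auto
        ultimately show ?thesis using fin(2) by (simp add: a_def card_insert_if)
      qed (simp add: a_def)
      have cF: "card (A i \<inter> F) = card (A i \<inter> (F - {m} - B)) + k + a"
      proof -
        have "A i \<inter> F = (A i \<inter> (F - {m} - B)) \<union> ((A i \<inter> B) \<union> (A i \<inter> {m}))" using B m by auto
        also have "card \<dots> = card (A i \<inter> (F - {m} - B)) + card ((A i \<inter> B) \<union> (A i \<inter> {m}))"
          using fin(3) finB by (intro card_Un_disjoint) auto
        also have "card ((A i \<inter> B) \<union> (A i \<inter> {m})) = card (A i \<inter> B) + card (A i \<inter> {m})"
          using B finB by (intro card_Un_disjoint) auto
        finally show ?thesis by (simp add: k_def a_def)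
      qed
      \<comment> \<open>The factors that the round leaves alone: the old term is
        \<open>f' * c ^ k * c ^ a\<close>, the new one \<open>f' * (1 - z i) ^ a\<close>.\<close>
      define f' where "f' = (1 - z i) ^ card (A i \<inter> M) * c ^ card (A i \<inter> (F - {m} - B))"
      have f'0: "0 \<le> f'" using assms(2) assms(6)[OF i] c by (simp add: f'_def)
      have ff': "f i = f' * c ^ k * c ^ a"
        by (simp add: f_def f'_def cF c_def power_add)
      have ua: "(1 - z i) ^ a \<le> (1 - real a * (1 - p) * z i) * c ^ a"
        using maker_factor_le[OF p, of "z i"] assms(2) assms(5,6)[OF i] by (auto simp: a_def c_def)
      have uk: "1 \<le> (1 + real k * \<kappa> * z i) * c ^ k"
        using inverse_power_le_linear[OF assms(1-3) _ _ kb assms(4), of "z i"] assms(5,6)[OF i]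
        by (simp add: c_def \<kappa>_def)
      have nn: "0 \<le> 1 - real a * (1 - p) * z i"
      proof -
        have "(1 - p) * z i \<le> 1" using p assms(2) assms(5,6)[OF i] by (intro mult_le_one) auto
        then show ?thesis by (simp add: a_def)
      qed
      have "(1 - z i) ^ card (A i \<inter> insert m M) * (1 - p * z i) ^ card (A i \<inter> (F - {m} - B))
          = f' * (1 - z i) ^ a"
        by (simp add: cM power_add f'_def c_def)
      also have "\<dots> \<le> f' * ((1 - real a * (1 - p) * z i) * c ^ a)"
        using ua f'0 by (rule mult_left_mono)
      also have "\<dots> \<le> f' * ((1 - real a * (1 - p) * z i) * c ^ a) * ((1 + real k * \<kappa> * z i) * c ^ k)"
        using mult_left_mono[OF uk, of "f' * ((1 - real a * (1 - p) * z i) * c ^ a)"] f'0 nn c by simp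
      also have "\<dots> = f i * ((1 - real a * (1 - p) * z i) * (1 + real k * \<kappa> * z i))"
        by (simp add: ff' mult_ac)
      \<comment> \<open>The mixed product has a negative sign and is dropped, so that the effects of
        the two players become additive and can be summed separately.\<close>
      also have "\<dots> \<le> f i * (1 - real a * (1 - p) * z i + real k * \<kappa> * z i)"
      proof (rule mult_left_mono[OF _ f0[OF i]])
        have "0 \<le> real a * (1 - p) * z i * (real k * \<kappa> * z i)"
          using p \<kappa> assms(5)[OF i] by simp
        then show "(1 - real a * (1 - p) * z i) * (1 + real k * \<kappa> * z i)
            \<le> 1 - real a * (1 - p) * z i + real k * \<kappa> * z i"
          by (simp add: algebra_simps)
      qed
      also have "\<dots> = f i - (1 - p) * (if m \<in> A i then f i * z i else 0)
          + \<kappa> * (\<Sum>x\<in>B. if x \<in> A i then f i * z i else 0)"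
        unfolding ks by (simp add: a_def algebra_simps)
      finally show "(1 - z i) ^ card (A i \<inter> insert m M) * (1 - p * z i) ^ card (A i \<inter> (F - {m} - B))
        \<le> f i - (1 - p) * (if m \<in> A i then f i * z i else 0)
          + \<kappa> * (\<Sum>x\<in>B. if x \<in> A i then f i * z i else 0)" .
    qed
    also have "\<dots> = sum f I - (1 - p) * D m + \<kappa> * (\<Sum>x\<in>B. D x)"
    proof -
      have "(\<Sum>x\<in>B. D x) = (\<Sum>i\<in>I. \<Sum>x\<in>B. if x \<in> A i then f i * z i else 0)"
        unfolding D_def by (rule sum.swap)
      then show ?thesis
        unfolding D_def by (simp only: sum.distrib sum_subtractf sum_distrib_left)
    qed
    also have "\<dots> \<le> sum f I - (1 - p) * D m + \<kappa> * (real b * D m)"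
    proof -
      have D0: "0 \<le> D m" unfolding D_def by (intro sum_nonneg) (use f0 assms(5) in auto)
      have "(\<Sum>x\<in>B. D x) \<le> real (card B) * D m"
        using B max by (intro sum_bounded_above) auto
      also have "\<dots> \<le> real b * D m" using B D0 by (intro mult_right_mono) auto
      finally show ?thesis using \<kappa> by (simp add: mult_left_mono)
    qed
    also have "\<dots> = potential p z I A M F"
    proof -
      have "\<kappa> * (real b * D m) = (1 - p) * D m" using \<kappa>(1) by (simp only: mult.assoc[symmetric])
      then show ?thesis unfolding potential_def f_def by simp
    qed
    finally show ?thesis .
  qed
  with m show ?thesis by blast
qed

text \<open>Maker only watches a subset \<open>F\<close> of the unclaimed elements and the subset \<open>M\<close> of his own
  elements that he has won from it. Whenever Breaker claims fewer than \<open>b\<close> elements of \<open>F\<close>, Maker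
  discards further ones. This does not spoil the potential, and it keeps the final set \<open>Y\<close> small
  even if Breaker passes.\<close>

lemma potential_strategy:
  fixes A :: "'i \<Rightarrow> 'a set"
  assumes "0 < \<delta>" "\<delta> < 1" "p = (1 - \<delta>) / (real b + 1)" "b \<ge> 1"
    and "finite X" "finite I"
    and "\<And>i. i \<in> I \<Longrightarrow> 0 \<le> \<eta> i" "\<And>i. i \<in> I \<Longrightarrow> \<eta> i \<le> \<delta>"
    and "(\<Sum>i\<in>I. (1 - p ^ s * \<eta> i) ^ card (A i \<inter> X)) < c"
  obtains \<sigma> where "legal_strategy X b \<sigma>"
    "\<And>hs h. reachable X b \<sigma> hs h \<Longrightarrow> length hs = s \<Longrightarrow>
      \<exists>Y\<subseteq>board X hs. real (card Y) \<le> real (card X) / (real b + 1) ^ s + 2 \<and>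
        (\<Sum>i\<in>I. (1 - \<eta> i) ^ card (A i \<inter> Y)) < c"
proof -
  have p: "0 < p" "p < 1" using potential_rate[OF assms(1-3)] by auto
  define K where "K j = real (card X) / (real b + 1) ^ j + 2" for j
  \<comment> \<open>The last stage runs with \<open>\<eta>\<close> itself and every earlier one with
    \<open>p\<close> times the value of its successor, which makes the potentials of consecutive
    stages fit together.\<close>
  define z where "z j i = p ^ (s - Suc j) * \<eta> i" for j i
  \<comment> \<open>A complete round does not increase \<open>(b + 1) * card M + card F\<close>.
    Only the round that exhausts \<open>F\<close> may be incomplete, hence the surplus
    \<open>b\<close> once \<open>F\<close> is empty.\<close>
  define virtual where "virtual hs h M F \<longleftrightarrow> M \<subseteq> maker_claimed h \<and> F \<subseteq> unclaimed X hs h \<and>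
    potential p (z (length hs)) I A M F < c \<and>
    (real b + 1) * card M + card F \<le> K (length hs) + (if F = {} then real b else 0)" for hs h M F
  define final where "final hs \<longleftrightarrow> (\<exists>Y\<subseteq>board X hs. real (card Y) \<le> K s \<and>
    (\<Sum>i\<in>I. (1 - \<eta> i) ^ card (A i \<inter> Y)) < c)" for hs
  define P where "P hs h \<longleftrightarrow> (length hs < s \<longrightarrow> (\<exists>M F. virtual hs h M F)) \<and>
    (length hs = s \<longrightarrow> final hs)" for hs h
  have z: "0 \<le> z j i" "z j i \<le> \<delta>" if "i \<in> I" for i j
  proof -
    show "0 \<le> z j i" using p assms(7)[OF that] by (simp add: z_def)
    have "z j i \<le> 1 * \<delta>" unfolding z_def
      using p assms(1) assms(7,8)[OF that] by (intro mult_mono power_le_one) auto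
    then show "z j i \<le> \<delta>" by simp
  qed
  have finF: "finite F" if "F \<subseteq> unclaimed X hs h" for F hs h
    using that finite_unclaimed[OF assms(5)] finite_subset by blast
  have finM: "finite M" if "M \<subseteq> maker_claimed h" for M :: "'a set" and h
    using that finite_maker_claimed finite_subset by blast
  have pz: "p * z j i = p ^ (s - j) * \<eta> i" if "j < s" for i j
    using that by (simp add: z_def power_Suc[symmetric] Suc_diff_Suc del: power_Suc flip: mult.assoc)
  show thesis
  proof (rule strategy_of_invariant[of P X b])
    show "P [] []"
    proof (cases s)
      case 0
      then show ?thesis using assms(9) by (auto simp: P_def final_def K_def intro!: exI[of _ X])
    next
      case (Suc s')
      then have "p * z 0 i = p ^ s * \<eta> i" for i using pz[of 0 i] by simp
      then have "virtual [] [] {} X"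
        using assms(9) by (simp add: virtual_def potential_def K_def)
      with Suc show ?thesis unfolding P_def by auto
    qed
  next
    fix hs and h :: "'a stage"
    assume P: "P hs h" and ne: "unclaimed X hs h \<noteq> {}"
    let ?U = "unclaimed X hs h"
    show "\<exists>m\<in>?U. \<forall>B. B \<subseteq> ?U - {m} \<longrightarrow> finite B \<longrightarrow> card B \<le> b \<longrightarrow> P hs (h @ [(m, B)])"
    proof (cases "length hs < s")
      case False
      with P ne show ?thesis by (auto simp: P_def)
    next
      case True
      then obtain M F where v: "virtual hs h M F" using P by (auto simp: P_def)
      then have M: "M \<subseteq> maker_claimed h" and F: "F \<subseteq> ?U"
        and pot: "potential p (z (length hs)) I A M F < c"
        and size: "(real b + 1) * card M + card F \<le> K (length hs) + (if F = {} then real b else 0)"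
        by (auto simp: virtual_def)
      show ?thesis
      proof (cases "F = {}")
        case empty: True
        \<comment> \<open>With \<open>F\<close> used up, the stage must still be played to its end;
          the watched position ignores these moves, so any of them will do.\<close>
        obtain m where m: "m \<in> ?U" using ne by blast
        have "P hs (h @ [(m, B)])" for B
        proof -
          have "virtual hs (h @ [(m, B)]) M F" using v empty by (auto simp: virtual_def)
          with True show ?thesis by (auto simp: P_def)
        qed
        with m show ?thesis by blast
      next
        case nonempty: False
        have "M \<inter> F = {}" using M F by (auto simp: unclaimed_def)
        then have "\<exists>m\<in>F. \<forall>B. B \<subseteq> F - {m} \<longrightarrow> card B \<le> b \<longrightarrow>
            potential p (z (length hs)) I A (insert m M) (F - {m} - B)
            \<le> potential p (z (length hs)) I A M F"
          using assms(1-4,6) z finM[OF M] finF[OF F] nonempty by (intro potential_round) auto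
        then obtain m where m: "m \<in> F" and le: "\<And>B. B \<subseteq> F - {m} \<Longrightarrow> card B \<le> b \<Longrightarrow>
            potential p (z (length hs)) I A (insert m M) (F - {m} - B)
            \<le> potential p (z (length hs)) I A M F"
          by blast
        have "P hs (h @ [(m, B)])" if B: "B \<subseteq> ?U - {m}" "finite B" "card B \<le> b" for B
        proof -
          have "B \<inter> F \<subseteq> F - {m}" "finite (F - {m})" using B finF[OF F] by auto
          moreover have "card (B \<inter> F) \<le> min b (card F - 1)"
          proof -
            have "card (B \<inter> F) \<le> card B" using B(2) by (intro card_mono) auto
            moreover have "card (B \<inter> F) \<le> card (F - {m})"
              using B(1) finF[OF F] by (intro card_mono) auto
            ultimately show ?thesis using B(3) m finF[OF F] by simp
          qed
          moreover have "min b (card F - 1) \<le> card (F - {m})" using m finF[OF F] by simp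
          \<comment> \<open>\<open>B'\<close> consists of Breaker's elements of \<open>F\<close> and
            of those that Maker discards.\<close>
          ultimately obtain B' where B': "B \<inter> F \<subseteq> B'" "B' \<subseteq> F - {m}" "card B' = min b (card F - 1)"
            using exists_subset_between[of "B \<inter> F" "min b (card F - 1)" "F - {m}"] by auto
          have finB': "finite B'" using B'(2) finF[OF F] finite_subset by blast
          let ?F = "F - {m} - B'"
          have cF: "card ?F = card F - 1 - min b (card F - 1)"
            using B' m finF[OF F] finB' by (simp add: card_Diff_subset)
          have pos: "card F > 0" using m finF[OF F] by (auto simp: card_gt_0_iff)
          have cM: "(real b + 1) * card (insert m M) \<le> (real b + 1) * card M + (real b + 1)"
          proof -
            have "real (card (insert m M)) \<le> card M + 1"
              using finM[OF M] by (simp add: card_insert_if)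
            then have "(real b + 1) * card (insert m M) \<le> (real b + 1) * (card M + 1)"
              by (intro mult_left_mono) auto
            then show ?thesis by (simp add: algebra_simps)
          qed
          have "(real b + 1) * card (insert m M) + card ?F
            \<le> K (length hs) + (if ?F = {} then real b else 0)"
          proof (cases "?F = {}")
            case True
            then show ?thesis using cM size pos nonempty by (simp only: card.empty) simp
          next
            case False
            then have "card ?F > 0" using finF[OF F] by (simp add: card_gt_0_iff)
            then have "card ?F + (b + 1) = card F" using cF by linarith
            then have "real (card ?F) + (real b + 1) = real (card F)" by linarith
            then show ?thesis using cM size False nonempty by simp
          qed
          moreover have "potential p (z (length hs)) I A (insert m M) ?F < c"
            using le[of B'] B' pot by linarith
          moreover have "insert m M \<subseteq> maker_claimed (h @ [(m, B)])" using M by auto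
          moreover have "?F \<subseteq> unclaimed X hs (h @ [(m, B)])"
            using F B' by (auto simp: unclaimed_snoc)
          ultimately have "virtual hs (h @ [(m, B)]) (insert m M) ?F" by (simp add: virtual_def)
          with True show ?thesis by (auto simp: P_def)
        qed
        with m F show ?thesis by blast
      qed
    qed
  next
    fix hs and h :: "'a stage"
    assume P: "P hs h" and e: "unclaimed X hs h = {}"
    show "P (hs @ [h]) []"
    proof (cases "length hs < s")
      case False
      then show ?thesis by (simp add: P_def)
    next
      case True
      then obtain M F where v: "virtual hs h M F" using P by (auto simp: P_def)
      with e have M: "M \<subseteq> maker_claimed h" and F: "F = {}" by (auto simp: virtual_def)
      have "(real b + 1) * card M \<le> K (length hs) + real b" using v F by (simp add: virtual_def)
      also have "\<dots> \<le> (real b + 1) * K (Suc (length hs))"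
        using assms(4) by (simp add: K_def distrib_left add_nonneg_eq_0_iff)
      finally have size: "real (card M) \<le> K (Suc (length hs))"
        by (rule mult_left_le_imp_le) simp
      have pot: "(\<Sum>i\<in>I. (1 - z (length hs) i) ^ card (A i \<inter> M)) < c"
        using v F by (simp add: virtual_def potential_def)
      show ?thesis
      proof (cases "Suc (length hs) = s")
        case True
        then have "final (hs @ [h])"
          using pot size M by (auto simp: final_def z_def intro!: exI[of _ M])
        with True show ?thesis by (simp add: P_def)
      next
        case False
        with True have less: "Suc (length hs) < s" by simp
        have "p * z (Suc (length hs)) i = z (length hs) i" for i
          using pz[OF less, of i] by (simp add: z_def)
        then have "virtual (hs @ [h]) [] {} M"
          using pot size M by (simp add: virtual_def potential_def)
        then have "\<exists>M F. virtual (hs @ [h]) [] M F" by blast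
        with less show ?thesis by (simp add: P_def)
      qed
    qed
  next
    fix \<sigma> assume "legal_strategy X b \<sigma>" "\<And>hs h. reachable X b \<sigma> hs h \<Longrightarrow> P hs h"
    then show thesis
      using that[of \<sigma>] by (simp add: P_def final_def K_def)
  qed
qed

text \<open>The right-hand side is the expectation of the left-hand side for a random subset \<open>G\<close> of \<open>F\<close>
  of density \<open>q\<close>.\<close>

lemma exists_subset_le_expectation:
  fixes q k :: real and A :: "'i \<Rightarrow> 'a set"
  assumes "0 \<le> q" "q \<le> 1" "finite I" "finite F"
  shows "\<exists>G\<subseteq>F. real (card {i\<in>I. A i \<inter> G = {}}) + k * real (card G)
    \<le> (\<Sum>i\<in>I. (1 - q) ^ card (A i \<inter> F)) + k * q * real (card F)"
  using assms(4,3)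
proof (induction F arbitrary: I rule: finite_induct)
  case empty
  then show ?case by simp
next
  case (insert x F)
  define I' where "I' = {i\<in>I. x \<notin> A i}"
  have fI': "finite I'" "I' \<subseteq> I" using insert.prems by (auto simp: I'_def)
  let ?S = "\<lambda>J. \<Sum>i\<in>J. (1 - q) ^ card (A i \<inter> F)"
  \<comment> \<open>Two options: \<open>x\<close> stays out and \<open>G\<close> has to hit all of
    \<open>I\<close>, or \<open>x\<close> goes in and \<open>G'\<close> has to hit only the sets of
    \<open>I'\<close>, which avoid \<open>x\<close>. Hence the induction for arbitrary
    \<open>I\<close>.\<close>
  obtain G where G: "G \<subseteq> F" "real (card {i\<in>I. A i \<inter> G = {}}) + k * real (card G)
    \<le> ?S I + k * q * real (card F)"
    using insert.IH[OF insert.prems] by blast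
  obtain G' where G': "G' \<subseteq> F" "real (card {i\<in>I'. A i \<inter> G' = {}}) + k * real (card G')
    \<le> ?S I' + k * q * real (card F)"
    using insert.IH[OF fI'(1)] by blast
  have split: "?S I = ?S I' + ?S (I - I')"
    using fI' insert.prems by (metis add.commute sum.subset_diff)
  have eq: "(\<Sum>i\<in>I. (1 - q) ^ card (A i \<inter> insert x F)) = ?S I' + (1 - q) * ?S (I - I')"
  proof -
    have "(\<Sum>i\<in>I. (1 - q) ^ card (A i \<inter> insert x F)) =
      (\<Sum>i\<in>I'. (1 - q) ^ card (A i \<inter> insert x F)) + (\<Sum>i\<in>I - I'. (1 - q) ^ card (A i \<inter> insert x F))"
      using fI' insert.prems by (metis add.commute sum.subset_diff)
    also have "(\<Sum>i\<in>I'. (1 - q) ^ card (A i \<inter> insert x F)) = ?S I'"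
      by (intro sum.cong) (auto simp: I'_def)
    also have "(\<Sum>i\<in>I - I'. (1 - q) ^ card (A i \<inter> insert x F)) = (1 - q) * ?S (I - I')"
      unfolding sum_distrib_left
      by (intro sum.cong) (use insert.hyps in \<open>auto simp: I'_def Int_insert_right card_insert_if\<close>)
    finally show ?thesis .
  qed
  define a where "a = ?S I"
  define a' where "a' = ?S I'"
  \<comment> \<open>Method of conditional expectations: up to the common summand
    \<open>k * q * card F\<close>, the bound to be shown is the average of the values of the two
    options with weights \<open>1 - q\<close> and \<open>q\<close>, so one option does not exceed
    it.\<close>
  have mix: "(1 - q) * a + q * (a' + k) = a' + (1 - q) * ?S (I - I') + q * k"
    using split by (simp add: a_def a'_def algebra_simps)
  have "min a (a' + k) \<le> (1 - q) * a + q * (a' + k)"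
  proof -
    have "(1 - q) * min a (a' + k) + q * min a (a' + k) \<le> (1 - q) * a + q * (a' + k)"
      using assms by (intro add_mono mult_left_mono) auto
    then show ?thesis by (simp add: algebra_simps)
  qed
  then have cases: "a \<le> a' + (1 - q) * ?S (I - I') + q * k \<or> a' + k \<le> a' + (1 - q) * ?S (I - I') + q * k"
    using mix by linarith
  have xF: "real (card (insert x F)) = real (card F) + 1" using insert.hyps by simp
  from cases show ?case
  proof
    assume "a \<le> a' + (1 - q) * ?S (I - I') + q * k"
    with G show ?thesis unfolding eq xF a_def a'_def
      by (intro exI[of _ G]) (auto simp: algebra_simps)
  next
    assume le: "a' + k \<le> a' + (1 - q) * ?S (I - I') + q * k"
    have "{i\<in>I. A i \<inter> insert x G' = {}} = {i\<in>I'. A i \<inter> G' = {}}" by (auto simp: I'_def)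
    moreover have "card (insert x G') = card G' + 1"
      using G' insert.hyps by (metis Suc_eq_plus1 card_insert_disjoint finite_subset in_mono)
    ultimately show ?thesis unfolding eq xF using G' le unfolding a'_def
      by (intro exI[of _ "insert x G'"]) (auto simp: algebra_simps)
  qed
qed

text \<open>One expectation controls both the missed sets and the size: with
  \<open>k = 1 / (2 * q * card F)\<close> the size contributes \<open>1 / 2\<close>, so some
  \<open>G\<close> has total value below 1. It misses no set, and \<open>card G\<close> is at most
  \<open>1 / k\<close>.\<close>

lemma exists_sparse_hitting_set:
  fixes q :: real and A :: "'i \<Rightarrow> 'a set"
  assumes "0 < q" "q \<le> 1" "finite I" "finite F"
    and "(\<Sum>i\<in>I. (1 - q) ^ card (A i \<inter> F)) < 1 / 2"
  obtains G where "G \<subseteq> F" "\<And>i. i \<in> I \<Longrightarrow> A i \<inter> G \<noteq> {}" "real (card G) \<le> 2 * q * real (card F)"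
proof (cases "F = {}")
  case True
  have "I = {}"
  proof (rule ccontr)
    assume "I \<noteq> {}"
    then have "real (card I) \<ge> 1" using assms(3) by (simp add: Suc_leI card_gt_0_iff)
    with assms(5) True show False by simp
  qed
  with that[of "{}"] assms(1) show thesis by simp
next
  case False
  define w where "w = q * real (card F)"
  have pos: "0 < w" using False assms by (simp add: w_def card_gt_0_iff)
  define k where "k = 1 / (2 * w)"
  have k0: "k > 0" "k * w = 1 / 2" using pos by (auto simp: k_def)
  then have k: "k > 0" "k * q * real (card F) = 1 / 2" by (auto simp: w_def mult.assoc)
  obtain G where G: "G \<subseteq> F" and le: "real (card {i\<in>I. A i \<inter> G = {}}) + k * real (card G)
    \<le> (\<Sum>i\<in>I. (1 - q) ^ card (A i \<inter> F)) + k * q * real (card F)"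
    using exists_subset_le_expectation[of q I F A k] assms by auto
  have less: "real (card {i\<in>I. A i \<inter> G = {}}) + k * real (card G) < 1"
    using le assms(5) k(2) by linarith
  moreover have "0 \<le> k * real (card G)" using k by simp
  ultimately have "real (card {i\<in>I. A i \<inter> G = {}}) < 1" by linarith
  then have "{i\<in>I. A i \<inter> G = {}} = {}" using assms(3) by simp
  moreover have "real (card G) \<le> 2 * q * real (card F)"
  proof -
    have "k * real (card G) \<le> 1" using less by linarith
    then have "real (card G) \<le> 2 * w" using pos by (simp add: k_def field_simps)
    then show ?thesis by (simp add: w_def mult.assoc)
  qed
  ultimately show thesis using that[OF G] by blast
qed

section \<open>Rotations and boosters\<close>

fun path_edges :: "'v list \<Rightarrow> 'v set set" where
  "path_edges (x # y # zs) = insert {x, y} (path_edges (y # zs))"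
| "path_edges _ = {}"

lemma path_edges_append:
  "path_edges (xs @ ys) = path_edges xs \<union> path_edges ys \<union>
    (if xs = [] \<or> ys = [] then {} else {{last xs, hd ys}})"
proof (induction xs rule: path_edges.induct)
  case ("2_2" v)
  then show ?case by (cases ys) auto
qed auto

lemma path_edges_rev [simp]: "path_edges (rev xs) = path_edges xs"
proof (induction xs rule: path_edges.induct)
  case (1 x y zs)
  have "path_edges (rev (x # y # zs)) = path_edges (rev (y # zs) @ [x])" by simp
  also have "\<dots> = insert {y, x} (path_edges (rev (y # zs)))"
    unfolding path_edges_append[of "rev (y # zs)"] by simp
  finally show ?case using 1 by (simp add: insert_commute)
qed auto

lemma path_edges_conv_nth: "path_edges xs = {{xs ! i, xs ! Suc i} | i. Suc i < length xs}"
proof (induction xs rule: path_edges.induct)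
  case (1 x y zs)
  show ?case
  proof (intro equalityI subsetI)
    fix e assume "e \<in> path_edges (x # y # zs)"
    then consider "e = {x, y}" | i where "e = {(y # zs) ! i, (y # zs) ! Suc i}" "Suc i < length (y # zs)"
      using 1 by auto
    then show "e \<in> {{(x # y # zs) ! i, (x # y # zs) ! Suc i} | i. Suc i < length (x # y # zs)}"
    proof cases
      case 1
      then show ?thesis by (intro CollectI exI[of _ 0]) simp
    next
      case (2 i)
      then show ?thesis by (intro CollectI exI[of _ "Suc i"]) simp
    qed
  next
    fix e assume "e \<in> {{(x # y # zs) ! i, (x # y # zs) ! Suc i} | i. Suc i < length (x # y # zs)}"
    then obtain i where "e = {(x # y # zs) ! i, (x # y # zs) ! Suc i}" "Suc i < length (x # y # zs)"
      by blast
    then show "e \<in> path_edges (x # y # zs)" using 1 by (cases i) auto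
  qed
qed auto

definition path_in :: "'v set \<Rightarrow> 'v set set \<Rightarrow> 'v list \<Rightarrow> bool" where
  "path_in V E xs \<longleftrightarrow> distinct xs \<and> set xs \<subseteq> V \<and> path_edges xs \<subseteq> E"

definition longest_path :: "'v set \<Rightarrow> 'v set set \<Rightarrow> 'v list \<Rightarrow> bool" where
  "longest_path V E P \<longleftrightarrow> path_in V E P \<and> (\<forall>Q. path_in V E Q \<longrightarrow> length Q \<le> length P)"

lemma length_path_le: "finite V \<Longrightarrow> path_in V E P \<Longrightarrow> length P \<le> card V"
  unfolding path_in_def by (metis card_mono distinct_card)

lemma longest_path_exists:
  assumes "finite V"
  obtains P where "longest_path V E P"
proof -
  have "path_in V E []" by (simp add: path_in_def)
  moreover have "\<forall>Q. path_in V E Q \<longrightarrow> length Q < Suc (card V)"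
    using length_path_le[OF assms] by (auto simp: less_Suc_eq_le)
  ultimately have "\<exists>P. path_in V E P \<and> (\<forall>Q. path_in V E Q \<longrightarrow> length Q \<le> length P)"
    by (rule ex_has_greatest_nat)
  then show thesis using that unfolding longest_path_def by blast
qed

text \<open>Posa's rotation with the first vertex fixed: the edge from the last vertex to the pivot
  \<open>z\<close> comes in, the edge \<open>{z, hd ys}\<close> goes out, and \<open>hd ys\<close>
  becomes the new end.\<close>

inductive rotated :: "'v set set \<Rightarrow> 'v list \<Rightarrow> 'v list \<Rightarrow> bool" for E P where
  rotated_refl: "rotated E P P"
| rotated_step: "rotated E P ((xs @ [z]) @ ys) \<Longrightarrow> ys \<noteq> [] \<Longrightarrow> {z, last ys} \<in> E
    \<Longrightarrow> rotated E P ((xs @ [z]) @ rev ys)"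

definition rotation_ends :: "'v set set \<Rightarrow> 'v list \<Rightarrow> 'v set" where
  "rotation_ends E P = last ` {Q. rotated E P Q}"

lemma rotated_path:
  assumes "rotated E P Q" "path_in V E P"
  shows "path_in V E Q \<and> set Q = set P \<and> length Q = length P \<and> hd Q = hd P"
  using assms
proof induction
  case (rotated_step xs z ys)
  let ?Q = "(xs @ [z]) @ ys" and ?Q' = "(xs @ [z]) @ rev ys"
  have IH: "path_in V E ?Q" "set ?Q = set P" "length ?Q = length P" "hd ?Q = hd P"
    using rotated_step by auto
  have "path_edges ?Q' \<subseteq> E"
    using IH(1) rotated_step.hyps unfolding path_in_def path_edges_append[of "xs @ [z]"]
    by (auto simp: hd_rev)
  then have "path_in V E ?Q'" using IH(1) by (auto simp: path_in_def)
  moreover have "hd ?Q' = hd ?Q" by (cases xs) auto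
  ultimately show ?case using IH by auto
qed simp

lemma rotated_longest_path:
  "rotated E P Q \<Longrightarrow> longest_path V E P \<Longrightarrow> longest_path V E Q"
  using rotated_path unfolding longest_path_def by metis

text \<open>As long as neither a vertex nor one of its neighbours on \<open>P\<close> becomes an end of a rotated
  path, rotations do not touch the path edges at this vertex.\<close>

lemma rotated_path_edges:
  assumes "rotated E P Q" "u \<notin> rotation_ends E P"
    and "\<And>v. {u, v} \<in> path_edges P \<Longrightarrow> v \<notin> rotation_ends E P"
  shows "{u, v} \<in> path_edges Q \<longleftrightarrow> {u, v} \<in> path_edges P"
  using assms(1)
proof (induction arbitrary: v)
  case (rotated_step xs z ys)
  let ?R = "rotation_ends E P"
  have "rotated E P ((xs @ [z]) @ rev ys)" using rotated_step.hyps by (rule rotated.rotated_step)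
  then have "last ((xs @ [z]) @ rev ys) \<in> ?R" unfolding rotation_ends_def by blast
  then have hd: "hd ys \<in> ?R" using rotated_step.hyps(2) by (simp add: last_rev)
  have "last ((xs @ [z]) @ ys) \<in> ?R"
    using rotated_step.hyps(1) unfolding rotation_ends_def by blast
  then have last: "last ys \<in> ?R" using rotated_step.hyps(2) by simp
  have "{z, hd ys} \<in> path_edges ((xs @ [z]) @ ys)"
    using rotated_step.hyps(2) unfolding path_edges_append[of "xs @ [z]"] by simp
  \<comment> \<open>If \<open>u\<close> were the pivot, the broken edge would by induction belong to
    \<open>P\<close> and join \<open>u\<close> to the rotation end \<open>hd ys\<close>.\<close>
  then have "u \<noteq> z" using rotated_step.IH[of "hd ys"] assms(3) hd by blast
  moreover have "u \<noteq> hd ys" "u \<noteq> last ys" using hd last assms(2) by auto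
  ultimately have "{u, v} \<noteq> {z, hd ys}" "{u, v} \<noteq> {z, last ys}" by (auto simp: doubleton_eq_iff)
  then have "{u, v} \<in> path_edges ((xs @ [z]) @ rev ys) \<longleftrightarrow> {u, v} \<in> path_edges ((xs @ [z]) @ ys)"
    using rotated_step.hyps(2) unfolding path_edges_append[of "xs @ [z]"] by (simp add: hd_rev)
  then show ?case using rotated_step.IH by simp
qed simp

section \<open>Expansion and Posa's lemma\<close>

definition graph_on :: "'v set \<Rightarrow> 'v set set \<Rightarrow> bool" where
  "graph_on V E \<longleftrightarrow> (\<forall>e\<in>E. e \<subseteq> V \<and> card e = 2)"

definition neighbourhood :: "'v set set \<Rightarrow> 'v set \<Rightarrow> 'v set" where
  "neighbourhood E A = {v. \<exists>u\<in>A. {u, v} \<in> E}"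

definition expander :: "'v set \<Rightarrow> 'v set set \<Rightarrow> nat \<Rightarrow> bool" where
  "expander V E k \<longleftrightarrow>
    (\<forall>A\<subseteq>V. A \<noteq> {} \<longrightarrow> card A \<le> k \<longrightarrow> 2 * card A < card (neighbourhood E A - A))"

lemma neighbourhood_subset: "graph_on V E \<Longrightarrow> neighbourhood E A \<subseteq> V"
  unfolding graph_on_def neighbourhood_def by blast

lemma expander_mono:
  assumes "expander V E k" "E \<subseteq> E'" "graph_on V E'" "finite V"
  shows "expander V E' k"
  unfolding expander_def
proof (intro allI impI)
  fix A assume A: "A \<subseteq> V" "A \<noteq> {}" "card A \<le> k"
  have "neighbourhood E A - A \<subseteq> neighbourhood E' A - A"
    using assms(2) by (auto simp: neighbourhood_def)
  moreover have "finite (neighbourhood E' A - A)"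
    using neighbourhood_subset[OF assms(3)] assms(4) finite_subset by blast
  ultimately have "card (neighbourhood E A - A) \<le> card (neighbourhood E' A - A)"
    by (intro card_mono)
  moreover have "2 * card A < card (neighbourhood E A - A)"
    using A assms(1) unfolding expander_def by blast
  ultimately show "2 * card A < card (neighbourhood E' A - A)" by linarith
qed

lemma rotation_ends_subset:
  assumes "path_in V E P" "P \<noteq> []"
  shows "rotation_ends E P \<subseteq> set P"
proof
  fix w assume "w \<in> rotation_ends E P"
  then obtain Q where Q: "rotated E P Q" "w = last Q" by (auto simp: rotation_ends_def)
  with rotated_path[OF Q(1) assms(1)] assms(2) show "w \<in> set P"
    by (metis last_in_set length_0_conv)
qed

text \<open>Posa's lemma. By maximality \<open>u\<close> lies on the path \<open>Q\<close> that ends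
  in its neighbour \<open>w\<close>, and rotating at \<open>u\<close> makes the successor of
  \<open>u\<close> on \<open>Q\<close> an end. If no neighbour of \<open>u\<close> on
  \<open>P\<close> were an end, the path edges at \<open>u\<close> would be the same in
  \<open>P\<close> and \<open>Q\<close>, and this successor would be such a neighbour.\<close>

lemma neighbourhood_rotation_ends:
  assumes P: "longest_path V E P" "P \<noteq> []" and E: "graph_on V E"
    and u: "u \<in> neighbourhood E (rotation_ends E P) - rotation_ends E P"
  shows "\<exists>v\<in>rotation_ends E P. {u, v} \<in> path_edges P"
proof (rule ccontr)
  assume no: "\<not> ?thesis"
  obtain w where w: "w \<in> rotation_ends E P" "{w, u} \<in> E" using u by (auto simp: neighbourhood_def)
  then obtain Q where Q: "rotated E P Q" "w = last Q" by (auto simp: rotation_ends_def)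
  have lQ: "longest_path V E Q" using rotated_longest_path[OF Q(1) P(1)] .
  then have pQ: "path_in V E Q" by (simp add: longest_path_def)
  have "length Q = length P" using rotated_path[OF Q(1)] P(1) by (auto simp: longest_path_def)
  then have Qne: "Q \<noteq> []" using P(2) by auto
  have "u \<in> set Q"
  proof (rule ccontr)
    assume "u \<notin> set Q"
    moreover have "u \<in> V" using w(2) E by (auto simp: graph_on_def)
    ultimately have "path_in V E (Q @ [u])"
      using pQ Qne w(2) Q(2) by (auto simp: path_in_def path_edges_append)
    with lQ show False by (auto simp: longest_path_def)
  qed
  then obtain xs ys where split: "Q = (xs @ [u]) @ ys"
    by (metis append.assoc append_Cons append_Nil split_list)
  have "ys \<noteq> []" using split Q(2) w(1) u by auto
  moreover have "{u, last ys} \<in> E" using w(2) Q(2) split \<open>ys \<noteq> []\<close> by (simp add: insert_commute)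
  ultimately have "rotated E P ((xs @ [u]) @ rev ys)" using Q(1) split rotated_step by metis
  then have "last ((xs @ [u]) @ rev ys) \<in> rotation_ends E P" unfolding rotation_ends_def by blast
  then have "hd ys \<in> rotation_ends E P" using \<open>ys \<noteq> []\<close> by (simp add: last_rev)
  moreover have "{u, hd ys} \<in> path_edges Q"
    using \<open>ys \<noteq> []\<close> unfolding split path_edges_append[of "xs @ [u]"] by simp
  ultimately show False
    using rotated_path_edges[OF Q(1), of u "hd ys"] u no by blast
qed

text \<open>A vertex has at most two neighbours on \<open>P\<close>, so by Posa's lemma the set of
  ends has at most twice its size in outer neighbours, whereas sets of at most \<open>k\<close>
  vertices expand by more.\<close>

lemma card_rotation_ends:
  assumes P: "longest_path V E P" "P \<noteq> []" and E: "graph_on V E" and V: "finite V"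
    and exp: "expander V E k"
  shows "k < card (rotation_ends E P)"
proof (rule ccontr)
  let ?R = "rotation_ends E P"
  assume "\<not> k < card ?R"
  have pP: "path_in V E P" using P(1) by (simp add: longest_path_def)
  have sub: "?R \<subseteq> set P" using rotation_ends_subset[OF pP P(2)] .
  have "last P \<in> ?R" using rotated_refl unfolding rotation_ends_def by blast
  then have "?R \<noteq> {}" by blast
  moreover have "?R \<subseteq> V" using sub pP by (auto simp: path_in_def)
  ultimately have "2 * card ?R < card (neighbourhood E ?R - ?R)"
    using exp \<open>\<not> k < card ?R\<close> unfolding expander_def by simp
  moreover have "card (neighbourhood E ?R - ?R) \<le> 2 * card ?R"
  proof -
    define J where "J = {i. i < length P \<and> P ! i \<in> ?R}"
    have J: "finite J" "card J \<le> card ?R"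
    proof -
      show "finite J" by (simp add: J_def)
      have "inj_on ((!) P) J"
        using pP by (auto simp: inj_on_def J_def path_in_def nth_eq_iff_index_eq)
      moreover have "(!) P ` J \<subseteq> ?R" by (auto simp: J_def)
      moreover have "finite ?R" using sub finite_subset by blast
      ultimately show "card J \<le> card ?R" by (metis card_inj_on_le)
    qed
    \<comment> \<open>Only a cover is needed, so the values at the two ends of the list, where
      \<open>i - 1\<close> is cut off at 0 or \<open>Suc i\<close> is out of range, do no
      harm.\<close>
    have "neighbourhood E ?R - ?R \<subseteq> (\<lambda>i. P ! (i - 1)) ` J \<union> (\<lambda>i. P ! Suc i) ` J"
    proof
      fix u assume "u \<in> neighbourhood E ?R - ?R"
      then obtain v where v: "v \<in> ?R" "{u, v} \<in> path_edges P"
        using neighbourhood_rotation_ends[OF P E] by blast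
      then obtain i where i: "{u, v} = {P ! i, P ! Suc i}" "Suc i < length P"
        by (auto simp: path_edges_conv_nth)
      then consider "u = P ! i" "v = P ! Suc i" | "u = P ! Suc i" "v = P ! i"
        by (auto simp: doubleton_eq_iff)
      then show "u \<in> (\<lambda>i. P ! (i - 1)) ` J \<union> (\<lambda>i. P ! Suc i) ` J"
      proof cases
        case 1
        then have "Suc i \<in> J" "u = P ! (Suc i - 1)" using i v by (auto simp: J_def)
        then show ?thesis by blast
      next
        case 2
        then have "i \<in> J" using i v by (auto simp: J_def)
        with 2 show ?thesis by blast
      qed
    qed
    then have "card (neighbourhood E ?R - ?R) \<le> card ((\<lambda>i. P ! (i - 1)) ` J \<union> (\<lambda>i. P ! Suc i) ` J)"
      using J(1) by (intro card_mono) auto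
    also have "\<dots> \<le> card J + card J"
      using card_Un_le card_image_le[OF J(1)] by (meson add_mono order_trans)
    finally show ?thesis using J(2) by simp
  qed
  ultimately show False by simp
qed

section \<open>Boosters of expanders\<close>

definition improves :: "'v set \<Rightarrow> 'v set set \<Rightarrow> 'v set set \<Rightarrow> bool" where
  "improves V E E' \<longleftrightarrow> (\<exists>vs. hamilton_cycle V E' vs) \<or>
    (\<exists>Q. path_in V E' Q \<and> (\<forall>P. path_in V E P \<longrightarrow> length P < length Q))"

text \<open>If \<open>E\<close> already has a Hamilton cycle, every pair of vertices is a booster;
  this case then needs no separate treatment.\<close>

definition boosters :: "'v set \<Rightarrow> 'v set set \<Rightarrow> 'v set set" where
  "boosters V E = {e. e \<subseteq> V \<and> card e = 2 \<and> improves V E (insert e E)}"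

lemma cycle_edges_subset:
  assumes "vs \<noteq> []"
  shows "cycle_edges vs \<subseteq> insert {hd vs, last vs} (path_edges vs)"
proof
  fix e assume "e \<in> cycle_edges vs"
  then obtain i where i: "i < length vs" "e = {vs ! i, vs ! (Suc i mod length vs)}"
    by (auto simp: cycle_edges_def)
  show "e \<in> insert {hd vs, last vs} (path_edges vs)"
  proof (cases "Suc i < length vs")
    case True
    with i show ?thesis by (auto simp: path_edges_conv_nth)
  next
    case False
    with i have "length vs = Suc i" by simp
    with i(2) assms have "e = {last vs, hd vs}" by (simp add: hd_conv_nth last_conv_nth)
    then show ?thesis by (simp add: insert_commute)
  qed
qed

text \<open>Connectivity. Let \<open>k = card V div 4\<close>. A nonempty set that no edge leaves
  has more than \<open>3 * k\<close> vertices, since it contains the neighbours of its subsets of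
  size \<open>k\<close>. Both sides of an edgeless cut would be such sets, but
  \<open>2 * (3 * k + 1) > card V\<close>.\<close>

lemma expander_cut:
  assumes exp: "expander V E (card V div 4)" and E: "graph_on V E" and V: "finite V" "4 \<le> card V"
    and S: "S \<subseteq> V" "S \<noteq> {}" "S \<noteq> V"
  shows "\<exists>z\<in>S. \<exists>y\<in>V - S. {z, y} \<in> E"
proof (rule ccontr)
  assume no: "\<not> ?thesis"
  have large: "3 * (card V div 4) < card T"
    if T: "T \<subseteq> V" "T \<noteq> {}" "neighbourhood E T \<subseteq> T" for T
  proof -
    have fT: "finite T" using T V finite_subset by blast
    have k: "1 \<le> card V div 4" using V by simp
    obtain A where A: "A \<subseteq> T" "card A = min (card V div 4) (card T)"
      using obtain_subset_with_card_n[of "min (card V div 4) (card T)" T] by auto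
    have "card T > 0" using T fT by (simp add: card_gt_0_iff)
    then have "A \<noteq> {}" using A k by auto
    moreover have "A \<subseteq> V" "card A \<le> card V div 4" using A T(1) by simp_all
    ultimately have "2 * card A < card (neighbourhood E A - A)"
      using exp unfolding expander_def by blast
    also have "\<dots> \<le> card (T - A)"
    proof (intro card_mono)
      show "neighbourhood E A - A \<subseteq> T - A" using T(3) A(1) by (auto simp: neighbourhood_def)
    qed (use fT in auto)
    also have "\<dots> = card T - card A" using A fT by (meson card_Diff_subset finite_subset)
    finally show ?thesis using A by linarith
  qed
  have S': "V - S \<subseteq> V" "V - S \<noteq> {}" using S by auto
  have nV: "neighbourhood E T \<subseteq> V" for T by (rule neighbourhood_subset[OF E])
  have "neighbourhood E S \<subseteq> S" using no nV[of S] by (auto simp: neighbourhood_def)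
  moreover have "neighbourhood E (V - S) \<subseteq> V - S"
    using no nV[of "V - S"] by (auto simp: neighbourhood_def insert_commute)
  ultimately have "3 * (card V div 4) < card S" "3 * (card V div 4) < card (V - S)"
    using large[OF S(1,2)] large[OF S'] by auto
  moreover have "card (V - S) = card V - card S" "card S \<le> card V"
    using S V by (auto simp: card_Diff_subset finite_subset card_mono)
  moreover have "card V < 4 * (card V div 4) + 4" "1 \<le> card V div 4" using V(2) by presburger+
  ultimately show False by linarith
qed

text \<open>The edge closes \<open>P\<close> to a cycle. If this is not spanning, some edge leaves
  it at a vertex \<open>z\<close>, and opening the cycle at \<open>z\<close> gives a longer path
  that starts outside.\<close>

lemma longest_path_closing_edge:
  assumes P: "longest_path V E P" "P \<noteq> []" and V: "finite V" "3 \<le> card V"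
    and cut: "\<And>S. S \<subseteq> V \<Longrightarrow> S \<noteq> {} \<Longrightarrow> S \<noteq> V \<Longrightarrow> \<exists>z\<in>S. \<exists>y\<in>V - S. {z, y} \<in> E"
  shows "improves V E (insert {hd P, last P} E)"
proof -
  let ?E = "insert {hd P, last P} E"
  have P': "distinct P" "set P \<subseteq> V" "path_edges P \<subseteq> E"
    using P(1) by (auto simp: longest_path_def path_in_def)
  show ?thesis
  proof (cases "set P = V")
    case True
    then have "length P = card V" using P'(1) distinct_card by fastforce
    then have "hamilton_cycle V ?E P"
      using V P' True cycle_edges_subset[OF P(2)] by (auto simp: hamilton_cycle_def)
    then show ?thesis unfolding improves_def by blast
  next
    case False
    then obtain z y where zy: "z \<in> set P" "y \<in> V - set P" "{z, y} \<in> E"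
      using cut[of "set P"] P' P(2) by auto
    obtain as bs where split: "P = (as @ [z]) @ bs"
      using zy(1) by (metis append.assoc append_Cons append_Nil split_list)
    let ?Q = "[y] @ ([z] @ bs) @ as"
    have "path_edges ?Q \<subseteq> ?E"
    proof -
      have "path_edges as \<subseteq> E" "path_edges bs \<subseteq> E" "bs \<noteq> [] \<Longrightarrow> {z, hd bs} \<in> E"
        using P'(3) unfolding split path_edges_append by (auto split: if_splits)
      moreover have "{last ([z] @ bs), hd as} = {hd P, last P}" if "as \<noteq> []"
        using that by (auto simp: split)
      moreover have "{y, z} \<in> E" using zy(3) by (simp add: insert_commute)
      ultimately show ?thesis unfolding path_edges_append by auto
    qed
    moreover have "distinct ?Q" "set ?Q \<subseteq> V" using P' zy by (auto simp: split)
    ultimately have "path_in V ?E ?Q" by (simp add: path_in_def)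
    moreover have "length Q < length ?Q" if "path_in V E Q" for Q
      using P(1) that by (fastforce simp: longest_path_def split)
    ultimately show ?thesis unfolding improves_def by blast
  qed
qed

text \<open>Posa's lemma is used twice. Rotations of a longest path give more than
  \<open>card V div 4\<close> ends \<open>w\<close>; reversing each resulting path and rotating with
  \<open>w\<close> fixed gives as many other ends \<open>x\<close>. Every \<open>{w, x}\<close> is a
  booster and arises from at most two ordered pairs.\<close>

lemma card_boosters:
  assumes exp: "expander V E (card V div 4)" and E: "graph_on V E" and V: "finite V" "4 \<le> card V"
  shows "(card V div 4 + 1)\<^sup>2 \<le> 2 * card (boosters V E)"
proof -
  let ?k = "card V div 4"
  have k: "1 \<le> ?k" using V by simp
  obtain P where P: "longest_path V E P" using longest_path_exists[OF V(1)] .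
  obtain v where "v \<in> V" using V(2) by fastforce
  then have "path_in V E [v]" by (simp add: path_in_def)
  then have "length [v] \<le> length P" using P unfolding longest_path_def by blast
  then have Pne: "P \<noteq> []" by auto
  have finB: "finite (boosters V E)"
    by (rule finite_subset[of _ "Pow V"]) (auto simp: boosters_def V)
  have finR: "finite (rotation_ends E Q)" if "longest_path V E Q" "Q \<noteq> []" for Q
    using rotation_ends_subset[of V E Q] that finite_subset unfolding longest_path_def by blast
  have ends: "\<exists>R. finite R \<and> ?k + 1 \<le> card R \<and> (\<forall>x\<in>R. {w, x} \<in> boosters V E)"
    if w: "w \<in> rotation_ends E P" for w
  proof -
    obtain Q where Q: "rotated E P Q" "w = last Q" using w by (auto simp: rotation_ends_def)
    define Q' where "Q' = rev Q"
    have lQ: "longest_path V E Q" using rotated_longest_path[OF Q(1) P] .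
    have "length Q = length P" using rotated_path[OF Q(1)] P by (auto simp: longest_path_def)
    then have Qne: "Q' \<noteq> []" using Pne by (auto simp: Q'_def)
    have lQ': "longest_path V E Q'"
      using lQ by (auto simp: longest_path_def path_in_def Q'_def)
    have hd: "hd Q' = w" using Q(2) by (simp add: Q'_def hd_rev)
    \<comment> \<open>With at least two vertices the ends of the path differ, so the closing pair is
      a genuine edge.\<close>
    have len: "2 \<le> length Q'"
    proof -
      have "card (rotation_ends E Q') \<le> card (set Q')"
        using rotation_ends_subset[of V E Q'] lQ' Qne
          by (intro card_mono) (auto simp: longest_path_def)
      also have "\<dots> \<le> length Q'" by (rule card_length)
      finally show ?thesis using card_rotation_ends[OF lQ' Qne E V(1) exp] k by simp
    qed
    have "{w, x} \<in> boosters V E" if x: "x \<in> rotation_ends E Q'" for x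
    proof -
      obtain Q2 where Q2: "rotated E Q' Q2" "x = last Q2" using x by (auto simp: rotation_ends_def)
      have l2: "longest_path V E Q2" using rotated_longest_path[OF Q2(1) lQ'] .
      have 2: "path_in V E Q2" "length Q2 = length Q'" "hd Q2 = w"
        using rotated_path[OF Q2(1)] lQ' hd by (auto simp: longest_path_def)
      have ne: "Q2 \<noteq> []" using 2 Qne by auto
      have "Q2 ! 0 \<noteq> Q2 ! (length Q2 - 1)"
        using 2(1,2) len by (subst nth_eq_iff_index_eq) (auto simp: path_in_def)
      then have "hd Q2 \<noteq> last Q2" using ne by (simp add: hd_conv_nth last_conv_nth)
      moreover have "hd Q2 \<in> V" "last Q2 \<in> V" using 2 ne by (auto simp: path_in_def)
      moreover have "improves V E (insert {hd Q2, last Q2} E)"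
        using longest_path_closing_edge[OF l2 ne V(1)] V(2) expander_cut[OF exp E V] by simp
      ultimately show ?thesis using 2(3) Q2(2) by (auto simp: boosters_def)
    qed
    moreover have "?k + 1 \<le> card (rotation_ends E Q')"
      using card_rotation_ends[OF lQ' Qne E V(1) exp] by simp
    ultimately show ?thesis using finR[OF lQ' Qne] by blast
  qed
  then obtain R where R: "\<And>w. w \<in> rotation_ends E P \<Longrightarrow> finite (R w) \<and> ?k + 1 \<le> card (R w) \<and>
      (\<forall>x\<in>R w. {w, x} \<in> boosters V E)" by metis
  have "(?k + 1)\<^sup>2 \<le> card (rotation_ends E P) * (?k + 1)"
    using card_rotation_ends[OF P Pne E V(1) exp]
      by (simp add: power2_eq_square del: mult_Suc mult_Suc_right)
  also have "\<dots> \<le> (\<Sum>w\<in>rotation_ends E P. card (R w))"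
    using sum_bounded_below[of "rotation_ends E P" "?k + 1" "\<lambda>w. card (R w)"] R by simp
  also have "\<dots> = card (Sigma (rotation_ends E P) R)"
    using R finR[OF P Pne] by simp
  also have "\<dots> \<le> card (\<Union>e\<in>boosters V E. {(w, x). {w, x} = e})"
  proof (rule card_mono)
    have "finite {(w, x). {w, x} = e}" if "e \<in> boosters V E" for e
      by (rule finite_subset[of _ "V \<times> V"]) (use that V in \<open>auto simp: boosters_def\<close>)
    then show "finite (\<Union>e\<in>boosters V E. {(w, x). {w, x} = e})" using finB by blast
  qed (use R in auto)
  also have "\<dots> \<le> (\<Sum>e\<in>boosters V E. card {(w, x). {w, x} = e})"
    using finB by (rule card_UN_le)
  also have "\<dots> \<le> (\<Sum>e\<in>boosters V E. 2)"
  proof (rule sum_mono)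
    fix e assume "e \<in> boosters V E"
    then obtain x y where "e = {x, y}" by (auto simp: boosters_def card_2_iff)
    then have "{(w, x). {w, x} = e} \<subseteq> {(x, y), (y, x)}" by (auto simp: doubleton_eq_iff)
    then have "card {(w, x). {w, x} = e} \<le> card {(x, y), (y, x)}" by (intro card_mono) auto
    also have "\<dots> \<le> Suc (card {(y, x)})" by (rule card_insert_le_m1) simp_all
    also have "\<dots> = 2" by simp
    finally show "card {(w, x). {w, x} = e} \<le> 2" .
  qed
  finally show ?thesis by simp
qed

lemma hamilton_cycle_mono: "hamilton_cycle V E vs \<Longrightarrow> E \<subseteq> E' \<Longrightarrow> hamilton_cycle V E' vs"
  by (auto simp: hamilton_cycle_def)

text \<open>Boosters from \<open>Y\<close> are added one at a time. Until a Hamilton cycle appears,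
  each one yields a longer path, so at most \<open>card V\<close> additions lengthen it, and
  \<open>m\<close> leaves room for these extra edges.\<close>

lemma hamilton_cycle_of_boosters:
  assumes V: "finite V" and Y: "graph_on V Y"
    and boost: "\<And>G. G \<subseteq> Y \<Longrightarrow> expander V G k \<Longrightarrow> card G \<le> m \<Longrightarrow> boosters V G \<inter> Y \<noteq> {}"
    and G: "G \<subseteq> Y" "expander V G k" "card G + card V \<le> m"
  shows "\<exists>vs. hamilton_cycle V Y vs"
proof -
  have finY: "finite Y" using V Y by (intro finite_subset[of Y "Pow V"]) (auto simp: graph_on_def)
  \<comment> \<open>\<open>j\<close> bounds the number of vertices missing from the current path; at
    \<open>j = 0\<close> the next booster must close a Hamilton cycle.\<close>
  have "\<exists>vs. hamilton_cycle V Y vs"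
    if "G \<subseteq> Y" "expander V G k" "path_in V G P" "card V \<le> length P + j" "card G + j \<le> m" for G P j
    using that
  proof (induction j arbitrary: G P rule: less_induct)
    case (less j)
    then obtain e where e: "e \<in> boosters V G" "e \<in> Y" using boost[of G] by auto
    let ?G = "insert e G"
    have G': "?G \<subseteq> Y" using less.prems e by auto
    then have "graph_on V ?G" using Y by (auto simp: graph_on_def)
    then have exp: "expander V ?G k" using expander_mono[OF less.prems(2) _ _ V] by blast
    from e(1) consider vs where "hamilton_cycle V ?G vs"
      | Q where "path_in V ?G Q" "length P < length Q"
      using less.prems(3) unfolding boosters_def improves_def by blast
    then show ?case
    proof cases
      case 1
      then show ?thesis using hamilton_cycle_mono G' by blast
    next
      case (2 Q)
      have "length Q \<le> card V" using length_path_le[OF V 2(1)] .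
      then have j: "j > 0" using 2 less.prems(4) by simp
      have "card ?G \<le> card G + 1"
        using finite_subset[OF less.prems(1) finY] by (simp add: card_insert_if)
      then have "card ?G + (j - 1) \<le> m" using less.prems(5) j by linarith
      moreover have "card V \<le> length Q + (j - 1)" using 2 less.prems(4) j by linarith
      ultimately show ?thesis using less.IH[of "j - 1" ?G Q] j G' exp 2 by simp
    qed
  qed
  from this[OF G(1,2), of "[]" "card V"] G(3) show ?thesis by (simp add: path_in_def)
qed

section \<open>The Hamilton cycle game\<close>

lemma finite_complete_graph_edges [simp]: "finite (complete_graph_edges n)"
  by (rule finite_subset[of _ "Pow {..<n}"]) (auto simp: complete_graph_edges_def)

lemma card_complete_graph_edges: "2 * card (complete_graph_edges n) = n * (n - 1)"
proof -
  have "card (complete_graph_edges n) = n choose 2"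
    unfolding complete_graph_edges_def using n_subsets[of "{..<n}" 2] by simp
  moreover have "even (n * (n - 1))" by (cases n) auto
  ultimately show ?thesis by (simp add: choose_two)
qed

lemma graph_on_complete: "Y \<subseteq> complete_graph_edges n \<Longrightarrow> graph_on {..<n} Y"
  by (auto simp: graph_on_def complete_graph_edges_def)

lemma boosters_subset: "boosters {..<n} E \<subseteq> complete_graph_edges n"
  by (auto simp: boosters_def complete_graph_edges_def)

section \<open>The upper bound on the number of stages\<close>

lemma card_cycle_edges:
  assumes "distinct vs" "3 \<le> length vs"
  shows "card (cycle_edges vs) = length vs"
proof -
  let ?f = "\<lambda>i. {vs ! i, vs ! (Suc i mod length vs)}"
  have "inj_on ?f {..<length vs}"
  proof (rule inj_onI)
    fix i j assume ij: "i \<in> {..<length vs}" "j \<in> {..<length vs}" and eq: "?f i = ?f j"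
    have m: "Suc k mod length vs < length vs" for k using assms(2) by (intro mod_less_divisor) linarith
    show "i = j"
    proof (rule ccontr)
      assume "i \<noteq> j"
      then have "vs ! i \<noteq> vs ! j" using assms(1) ij by (simp add: nth_eq_iff_index_eq)
      then have "vs ! i = vs ! (Suc j mod length vs)" "vs ! (Suc i mod length vs) = vs ! j"
        using eq by (auto simp: doubleton_eq_iff)
      then have "i = Suc j mod length vs" "Suc i mod length vs = j"
        using assms(1) ij m by (auto simp: nth_eq_iff_index_eq)
      \<comment> \<open>Each position would be the cyclic successor of the other, which a cycle of
        length at least 3 excludes.\<close>
      then show False using assms(2) ij by (auto simp: mod_Suc split: if_splits)
    qed
  qed
  moreover have "cycle_edges vs = ?f ` {..<length vs}" by (auto simp: cycle_edges_def)
  ultimately show ?thesis by (simp add: card_image)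
qed

lemma hamilton_cycle_length: "hamilton_cycle {..<n} E vs \<Longrightarrow> length vs = n"
  unfolding hamilton_cycle_def by (metis card_lessThan distinct_card)

lemma HAM_subset_board: "W \<in> snd (HAM n) \<Longrightarrow> W \<subseteq> fst (HAM n)"
  by (auto simp: HAM_def hamilton_cycle_def)

text \<open>Against full play by Breaker the last board has at most
  \<open>n * (n - 1) / (2 * (b + 1) ^ s) + 2\<close> edges and must contain the \<open>n\<close>
  edges of a cycle. The additive 2 is absorbed because \<open>n - 1 \<le> 2 * (n - 2)\<close> for
  \<open>n \<ge> 3\<close>.\<close>

lemma maker_can_ensure_HAM_le:
  assumes "maker_can_ensure (HAM n) b s" "b \<ge> 1" "n \<ge> 3"
  shows "(real b + 1) ^ s \<le> real n"
proof -
  let ?X = "complete_graph_edges n"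
  have fst: "fst (HAM n) = ?X" by (simp add: HAM_def)
  obtain \<sigma> where \<sigma>: "legal_strategy ?X b \<sigma>"
    "\<And>hs h. reachable ?X b \<sigma> hs h \<Longrightarrow> length hs = s \<Longrightarrow> winning_sets (snd (HAM n)) hs \<noteq> {}"
    using assms(1) unfolding maker_can_ensure_def fst by blast
  obtain hs where hs: "reachable ?X b \<sigma> hs []" "length hs = s"
    "real (card (board ?X hs)) \<le> real (card ?X) / (real b + 1) ^ s + 2"
    using reachable_full_stages[OF \<sigma>(1) _ assms(2), of s] by auto
  obtain W where W: "W \<in> winning_sets (snd (HAM n)) hs" using \<sigma>(2)[OF hs(1,2)] by blast
  have W: "W \<in> snd (HAM n)" "W \<subseteq> board ?X hs"
    using reachable_winning_sets[OF hs(1), of "snd (HAM n)"] HAM_subset_board[of _ n] W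
    unfolding fst by auto
  from W(1) obtain vs where vs: "W = cycle_edges vs" "hamilton_cycle {..<n} ?X vs"
    by (auto simp: HAM_def)
  have "n = card W"
    using vs card_cycle_edges[of vs] hamilton_cycle_length[OF vs(2)] by (simp add: hamilton_cycle_def)
  also have "\<dots> \<le> card (board ?X hs)"
    using W(2) by (intro card_mono finite_board) auto
  finally have "real n \<le> real (card ?X) / (real b + 1) ^ s + 2" using hs(3) by linarith
  then have "(real n - 2) * (real b + 1) ^ s \<le> real (card ?X)" by (simp add: field_simps)
  also have "real (card ?X) = real n * (real n - 1) / 2"
  proof -
    have "real (2 * card ?X) = real (n * (n - 1))" by (simp only: card_complete_graph_edges)
    then show ?thesis using assms(3) by simp
  qed
  also have "\<dots> \<le> (real n - 2) * real n"
  proof -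
    have "0 \<le> (real n - 3) * real n" using assms(3) by simp
    then show ?thesis by (simp add: field_simps)
  qed
  finally show ?thesis using assms(3) by simp
qed

section \<open>Counting cuts and booster sets\<close>

definition crossing_edges :: "'v set \<Rightarrow> 'v set \<Rightarrow> 'v set set" where
  "crossing_edges A C = (\<lambda>(u, v). {u, v}) ` (A \<times> C)"

lemma card_crossing_edges:
  assumes "A \<inter> C = {}"
  shows "card (crossing_edges A C) = card A * card C"
proof -
  have "inj_on (\<lambda>(u, v). {u, v}) (A \<times> C)"
    using assms by (auto simp: inj_on_def doubleton_eq_iff)
  then show ?thesis by (simp add: crossing_edges_def card_image card_cartesian_product)
qed

text \<open>The pairs of a set \<open>A\<close> of size \<open>a\<close> and a set \<open>B\<close> of size \<open>2 * a\<close> which might contain all neighbours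
  of \<open>A\<close> are represented by lists, which are easy to count.\<close>

definition cut_index :: "nat \<Rightarrow> (nat \<times> nat list \<times> nat list) set" where
  "cut_index n = (SIGMA a:{1..n div 4}. {xs. set xs \<subseteq> {..<n} \<and> length xs = a \<and> distinct xs} \<times>
    {ys. set ys \<subseteq> {..<n} \<and> length ys = 2 * a})"

definition cut :: "nat \<Rightarrow> nat \<times> nat list \<times> nat list \<Rightarrow> nat set set" where
  "cut n = (\<lambda>(a, xs, ys). crossing_edges (set xs) ({..<n} - set xs - set ys))"

lemma finite_cut_index [simp]: "finite (cut_index n)"
proof -
  have "finite {xs. set xs \<subseteq> {..<n} \<and> length xs = a \<and> distinct xs}" for a
    by (rule finite_subset[OF _ finite_lists_length_eq[of "{..<n}" a]]) auto
  then show ?thesis by (auto simp: cut_index_def finite_lists_length_eq)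
qed

lemma cut_subset: "i \<in> cut_index n \<Longrightarrow> cut n i \<subseteq> complete_graph_edges n"
  by (auto simp: cut_index_def cut_def crossing_edges_def complete_graph_edges_def card_insert_if)

text \<open>If \<open>A\<close> did not expand, its outer neighbours could be padded to a set
  \<open>B\<close> of size \<open>2 * card A\<close>, and the cut between \<open>A\<close> and the
  rest would contain no edge of \<open>G\<close>.\<close>

lemma expander_of_cuts:
  assumes G: "G \<subseteq> complete_graph_edges n"
    and hit: "\<And>i. i \<in> cut_index n \<Longrightarrow> cut n i \<inter> G \<noteq> {}"
  shows "expander {..<n} G (n div 4)"
  unfolding expander_def
proof (intro allI impI, rule ccontr)
  fix A assume A: "A \<subseteq> {..<n}" "A \<noteq> {}" "card A \<le> n div 4"
    and small: "\<not> 2 * card A < card (neighbourhood G A - A)"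
  have finA: "finite A" using A(1) finite_subset by blast
  then have a: "1 \<le> card A" using A(2) by (simp add: Suc_leI card_gt_0_iff)
  have "neighbourhood G A - A \<subseteq> {..<n}"
    using neighbourhood_subset[OF graph_on_complete[OF G]] by blast
  moreover have "2 * card A \<le> card {..<n}" using A(3) by simp
  ultimately obtain B where B: "neighbourhood G A - A \<subseteq> B" "B \<subseteq> {..<n}" "card B = 2 * card A"
    using exists_subset_between[of "neighbourhood G A - A" "2 * card A" "{..<n}"] small by auto
  have "finite B" using B(2) finite_subset by blast
  then obtain ys where ys: "set ys = B" "distinct ys" using finite_distinct_list by blast
  obtain xs where xs: "set xs = A" "distinct xs" using finite_distinct_list[OF finA] by blast
  have "length xs = card A" "length ys = 2 * card A"
    using xs ys B(3) distinct_card by metis+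
  then have "(card A, xs, ys) \<in> cut_index n" using A B xs ys a by (auto simp: cut_index_def)
  from hit[OF this] obtain u v where "u \<in> A" "v \<notin> A" "v \<notin> B" "{u, v} \<in> G"
    using xs ys by (auto simp: cut_def crossing_edges_def)
  then show False using B(1) by (auto simp: neighbourhood_def)
qed

lemma power_le_exp:
  assumes "q \<le> 1" "x \<le> real k" "0 \<le> q"
  shows "(1 - q) ^ k \<le> exp (- (q * x))"
proof -
  have "(1 - q) ^ k \<le> exp (- q) ^ k"
    using exp_ge_add_one_self[of "- q"] assms by (intro power_mono) auto
  also have "\<dots> = exp (- (q * real k))" by (simp add: exp_of_nat_mult[symmetric] mult.commute)
  also have "\<dots> \<le> exp (- (q * x))" using assms by (simp add: mult_left_mono)
  finally show ?thesis .
qed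

text \<open>At least \<open>n - 3 * a \<ge> n / 4\<close> vertices lie outside both lists;
  repetitions in \<open>ys\<close> only add to them, while \<open>xs\<close> is distinct and
  supplies the factor \<open>a\<close>.\<close>

lemma card_cut:
  assumes "(a, xs, ys) \<in> cut_index n"
  shows "real a * (real n / 4) \<le> real (card (cut n (a, xs, ys)))"
proof -
  have *: "set xs \<subseteq> {..<n}" "length xs = a" "distinct xs" "length ys = 2 * a" "a \<le> n div 4"
    using assms by (auto simp: cut_index_def)
  have "card {..<n} - card (set xs) - card (set ys) \<le> card ({..<n} - set xs - set ys)"
    using diff_card_le_card_Diff[of "set xs" "{..<n}"] diff_card_le_card_Diff[of "set ys" "{..<n} - set xs"]
    by simp
  moreover have "card (set xs) = a" using * distinct_card by metis
  moreover have "card (set ys) \<le> 2 * a" using * card_length by metis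
  ultimately have "n - 3 * a \<le> card ({..<n} - set xs - set ys)" by simp
  then have "real n - 3 * real a \<le> card ({..<n} - set xs - set ys)" by linarith
  moreover have "real a \<le> real n / 4" using *(5) by linarith
  ultimately have "real n / 4 \<le> card ({..<n} - set xs - set ys)" by linarith
  then have "real a * (real n / 4) \<le> real a * card ({..<n} - set xs - set ys)"
    by (intro mult_left_mono) auto
  also have "\<dots> = real (card (cut n (a, xs, ys)))"
  proof -
    have "card (cut n (a, xs, ys)) = card (set xs) * card ({..<n} - set xs - set ys)"
      unfolding cut_def split by (intro card_crossing_edges) auto
    then show ?thesis using \<open>card (set xs) = a\<close> by simp
  qed
  finally show ?thesis .
qed

text \<open>The at most \<open>n ^ (3 * a)\<close> cuts for size \<open>a\<close> contribute at most
  \<open>y ^ a \<le> y\<close> with \<open>y = n ^ 3 * exp (- q * n / 4)\<close>: the exponent grows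
  with \<open>a\<close> as fast as the entropy.\<close>

lemma sum_cut_index:
  assumes q: "0 \<le> q" "q \<le> 1" and small: "real n ^ 3 * exp (- (q * (real n / 4))) \<le> 1"
  shows "(\<Sum>i\<in>cut_index n. (1 - q) ^ card (cut n i)) \<le> real n ^ 4 * exp (- (q * (real n / 4)))"
proof -
  define y where "y = real n ^ 3 * exp (- (q * (real n / 4)))"
  have y: "0 \<le> y" "y \<le> 1" using small by (auto simp: y_def)
  define L where "L a = {xs. set xs \<subseteq> {..<n} \<and> length xs = a \<and> distinct xs} \<times>
    {ys. set ys \<subseteq> {..<n} \<and> length ys = 2 * a}" for a
  have L: "finite (L a)" "card (L a) \<le> n ^ (3 * a)" for a
  proof -
    let ?A = "{xs. set xs \<subseteq> {..<n} \<and> length xs = a}"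
    let ?A' = "{xs. set xs \<subseteq> {..<n} \<and> length xs = a \<and> distinct xs}"
    let ?B = "{ys. set ys \<subseteq> {..<n} \<and> length ys = 2 * a}"
    have fin: "finite ?A" "finite ?B" by (auto simp: finite_lists_length_eq)
    have sub: "?A' \<subseteq> ?A" by auto
    then have fin': "finite ?A'" using fin finite_subset by blast
    then show "finite (L a)" using fin by (simp add: L_def)
    have "card (L a) = card ?A' * card ?B" by (simp add: L_def card_cartesian_product)
    also have "\<dots> \<le> card ?A * card ?B" using card_mono[OF fin(1) sub] by (rule mult_right_mono) simp
    also have "\<dots> = n ^ a * n ^ (2 * a)" by (simp add: card_lists_length_eq)
    also have "\<dots> = n ^ (3 * a)" by (simp add: power_add[symmetric])
    finally show "card (L a) \<le> n ^ (3 * a)" .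
  qed
  have "(\<Sum>i\<in>cut_index n. (1 - q) ^ card (cut n i)) = (\<Sum>a\<in>{1..n div 4}. \<Sum>l\<in>L a. (1 - q) ^ card (cut n (a, l)))"
    unfolding cut_index_def L_def[symmetric] using L(1)
      by (subst sum.Sigma) (auto simp: case_prod_unfold)
  also have "\<dots> \<le> (\<Sum>a\<in>{1..n div 4}. y)"
  proof (rule sum_mono)
    fix a assume a: "a \<in> {1..n div 4}"
    have "(\<Sum>l\<in>L a. (1 - q) ^ card (cut n (a, l))) \<le> of_nat (card (L a)) * exp (- (q * (real n / 4))) ^ a"
    proof (rule sum_bounded_above)
      fix l assume l: "l \<in> L a"
      obtain xs ys where [simp]: "l = (xs, ys)" by (cases l)
      have "(a, xs, ys) \<in> cut_index n" using a l by (auto simp: cut_index_def L_def)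
      then have "(1 - q) ^ card (cut n (a, l)) \<le> exp (- (q * (real a * (real n / 4))))"
        using card_cut q by (intro power_le_exp) auto
      also have "\<dots> = exp (- (q * (real n / 4))) ^ a"
        unfolding exp_of_nat_mult[symmetric] by (simp add: mult_ac)
      finally show "(1 - q) ^ card (cut n (a, l)) \<le> exp (- (q * (real n / 4))) ^ a" .
    qed
    also have "\<dots> \<le> real (n ^ (3 * a)) * exp (- (q * (real n / 4))) ^ a"
      using L(2)[of a] by (intro mult_right_mono of_nat_mono) auto
    also have "\<dots> = y ^ a" by (simp add: y_def power_mult power_mult_distrib)
    also have "\<dots> \<le> y ^ 1" using y a by (intro power_decreasing) auto
    finally show "(\<Sum>l\<in>L a. (1 - q) ^ card (cut n (a, l))) \<le> y" by simp
  qed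
  also have "\<dots> = real (n div 4) * y" by simp
  also have "\<dots> \<le> real n * y" using y by (intro mult_right_mono) auto
  also have "\<dots> = real n ^ 4 * exp (- (q * (real n / 4)))"
    by (simp add: y_def power_Suc[symmetric] flip: mult.assoc)
  finally show ?thesis .
qed

text \<open>Lists with repetitions allow a fixed length \<open>m\<close> and still represent all
  nonempty expanders with at most \<open>m\<close> edges.\<close>

definition booster_index :: "nat \<Rightarrow> nat \<Rightarrow> nat set list set" where
  "booster_index n m = {xs. set xs \<subseteq> complete_graph_edges n \<and> length xs = m \<and>
    expander {..<n} (set xs) (n div 4)}"

lemma finite_booster_index [simp]: "finite (booster_index n m)"
  by (rule finite_subset[OF _ finite_lists_length_eq[of "complete_graph_edges n" m]])
    (auto simp: booster_index_def)

text \<open>There are at most \<open>n ^ (2 * m)\<close> lists, and \<open>card_boosters\<close>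
  gives at least \<open>(n / 4)\<^sup>2 / 2\<close> boosters for each.\<close>

lemma sum_booster_index:
  assumes q: "0 \<le> q" "q \<le> 1" and n: "4 \<le> n"
  shows "(\<Sum>xs\<in>booster_index n m. (1 - q) ^ card (boosters {..<n} (set xs)))
    \<le> real n ^ (2 * m) * exp (- (q * (real n ^ 2 / 32)))"
proof -
  have "(\<Sum>xs\<in>booster_index n m. (1 - q) ^ card (boosters {..<n} (set xs)))
    \<le> of_nat (card (booster_index n m)) * exp (- (q * (real n ^ 2 / 32)))"
  proof (rule sum_bounded_above)
    fix xs assume xs: "xs \<in> booster_index n m"
    have "(n div 4 + 1)\<^sup>2 \<le> 2 * card (boosters {..<n} (set xs))"
      using card_boosters[of "{..<n}" "set xs"] xs graph_on_complete n
        by (auto simp: booster_index_def)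
    then have "real ((n div 4 + 1)\<^sup>2) \<le> real (2 * card (boosters {..<n} (set xs)))"
      by (rule of_nat_mono)
    then have "(real (n div 4) + 1)\<^sup>2 \<le> 2 * real (card (boosters {..<n} (set xs)))"
      by (simp add: add.commute)
    moreover have "(real n / 4)\<^sup>2 \<le> (real (n div 4) + 1)\<^sup>2"
    proof (intro power_mono)
      have "n \<le> 4 * (n div 4) + 4" by presburger
      then have "real n \<le> real (4 * (n div 4) + 4)" by (rule of_nat_mono)
      then show "real n / 4 \<le> real (n div 4) + 1" by simp
    qed simp
    ultimately have "real n ^ 2 / 32 \<le> real (card (boosters {..<n} (set xs)))"
      by (simp add: power_divide)
    then show "(1 - q) ^ card (boosters {..<n} (set xs)) \<le> exp (- (q * (real n ^ 2 / 32)))"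
      using q by (intro power_le_exp) auto
  qed
  also have "\<dots> \<le> real n ^ (2 * m) * exp (- (q * (real n ^ 2 / 32)))"
  proof (rule mult_right_mono)
    have "card (booster_index n m) \<le> card {xs. set xs \<subseteq> complete_graph_edges n \<and> length xs = m}"
      by (rule card_mono) (auto simp: booster_index_def finite_lists_length_eq)
    also have "\<dots> = card (complete_graph_edges n) ^ m" by (simp add: card_lists_length_eq)
    also have "\<dots> \<le> (n ^ 2) ^ m"
    proof (rule power_mono)
      have "n * (n - 1) \<le> n ^ 2" by (simp add: power2_eq_square)
      then show "card (complete_graph_edges n) \<le> n ^ 2"
        using card_complete_graph_edges[of n] by linarith
    qed simp
    also have "\<dots> = n ^ (2 * m)" by (simp add: power_mult)
    finally have "real (card (booster_index n m)) \<le> real (n ^ (2 * m))" by (rule of_nat_mono)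
    then show "real (card (booster_index n m)) \<le> real n ^ (2 * m)" by simp
  qed simp
  finally show ?thesis .
qed

section \<open>The lower bound for fixed parameters\<close>

lemma list_of_length:
  assumes "finite A" "A \<noteq> {}" "card A \<le> m"
  obtains xs where "set xs = A" "length xs = m"
proof -
  obtain ys where ys: "set ys = A" "distinct ys" using finite_distinct_list[OF assms(1)] by blast
  then have len: "length ys = card A" by (metis distinct_card)
  obtain a where a: "a \<in> A" using assms(2) by blast
  show thesis
  proof
    show "set (ys @ replicate (m - card A) a) = A" using ys a by (auto simp: set_replicate_conv_if)
    show "length (ys @ replicate (m - card A) a) = m" using len assms(3) by simp
  qed
qed

text \<open>Two rates are used. Cuts get the small rate \<open>\<eta>\<close>, which is also the
  density of the hitting set \<open>G\<close> and keeps it sparse; booster sets get the full rate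
  \<open>\<delta>\<close> to beat the number of lists. The bound \<open>m\<close> covers
  \<open>card G\<close> and the \<open>n\<close> boosters added later.\<close>

lemma maker_can_ensure_HAM:
  assumes n: "4 \<le> n" and b: "b \<ge> 1"
    and \<delta>: "0 < \<delta>" "\<delta> < 1" "p = (1 - \<delta>) / (real b + 1)" and \<eta>: "0 < \<eta>" "\<eta> \<le> \<delta>"
    and cuts: "real n ^ 4 * exp (- (p ^ s * \<eta> * (real n / 4))) < 1 / 4"
    and boost: "real n ^ (2 * m) * exp (- (p ^ s * \<delta> * (real n ^ 2 / 32))) < 1 / 4"
    and m: "2 * \<eta> * (real n ^ 2 / (real b + 1) ^ s + 2) + real n \<le> real m"
  shows "maker_can_ensure (HAM n) b s"
proof -
  let ?X = "complete_graph_edges n" and ?V = "{..<n}"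
  define I where "I = cut_index n <+> booster_index n m"
  define A where "A = case_sum (cut n) (\<lambda>xs. boosters ?V (set xs))"
  define e where "e = case_sum (\<lambda>_ :: nat \<times> nat list \<times> nat list. \<eta>) (\<lambda>_ :: nat set list. \<delta>)"
  have p: "0 < p" "p < 1" using potential_rate[OF \<delta>] by auto
  have e: "0 \<le> e i" "e i \<le> \<delta>" for i using \<eta> by (auto simp: e_def split: sum.split)
  have ps: "0 \<le> p ^ s * x" "p ^ s * x \<le> 1" if "0 \<le> x" "x \<le> \<delta>" for x
    using p that \<delta> by (auto intro!: mult_le_one power_le_one)
  have AX: "A i \<inter> ?X = A i" if "i \<in> I" for i
  proof (cases i)
    case (Inl a)
    then show ?thesis using that cut_subset[of a n] by (auto simp: I_def A_def)
  next
    case (Inr xs)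
    then show ?thesis using boosters_subset[of n "set xs"] by (auto simp: A_def)
  qed
  have "(\<Sum>i\<in>I. (1 - p ^ s * e i) ^ card (A i \<inter> ?X)) = (\<Sum>i\<in>I. (1 - p ^ s * e i) ^ card (A i))"
    using AX by simp
  also have "\<dots> = (\<Sum>i\<in>cut_index n. (1 - p ^ s * \<eta>) ^ card (cut n i)) +
      (\<Sum>xs\<in>booster_index n m. (1 - p ^ s * \<delta>) ^ card (boosters ?V (set xs)))"
    by (simp add: I_def sum.Plus A_def e_def)
  also have "\<dots> \<le> real n ^ 4 * exp (- (p ^ s * \<eta> * (real n / 4))) +
      real n ^ (2 * m) * exp (- (p ^ s * \<delta> * (real n ^ 2 / 32)))"
  proof (intro add_mono sum_cut_index sum_booster_index ps n)
    have "real n ^ 3 \<le> real n ^ 4" using n by (intro power_increasing) auto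
    then have "real n ^ 3 * exp (- (p ^ s * \<eta> * (real n / 4))) \<le> real n ^ 4 * exp (- (p ^ s * \<eta> * (real n / 4)))"
      by (rule mult_right_mono) simp
    then show "real n ^ 3 * exp (- (p ^ s * \<eta> * (real n / 4))) \<le> 1" using cuts by linarith
  qed (use \<eta> \<delta> in auto)
  also have "\<dots> < 1 / 2" using cuts boost by linarith
  finally have start: "(\<Sum>i\<in>I. (1 - p ^ s * e i) ^ card (A i \<inter> ?X)) < 1 / 2" .
  have finI: "finite I" by (simp add: I_def)
  obtain \<sigma> where \<sigma>: "legal_strategy ?X b \<sigma>" and Y: "\<And>hs h. reachable ?X b \<sigma> hs h \<Longrightarrow> length hs = s \<Longrightarrow>
      \<exists>Y\<subseteq>board ?X hs. real (card Y) \<le> real (card ?X) / (real b + 1) ^ s + 2 \<and>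
        (\<Sum>i\<in>I. (1 - e i) ^ card (A i \<inter> Y)) < 1 / 2"
    using potential_strategy[where I = I and A = A and \<eta> = e, OF \<delta> b finite_complete_graph_edges finI e start]
    by blast
  have "winning_sets (snd (HAM n)) hs \<noteq> {}" if r: "reachable ?X b \<sigma> hs h" "length hs = s" for hs h
  proof -
    obtain Y where Yb: "Y \<subseteq> board ?X hs" and cY: "real (card Y) \<le> real (card ?X) / (real b + 1) ^ s + 2"
      and sum: "(\<Sum>i\<in>I. (1 - e i) ^ card (A i \<inter> Y)) < 1 / 2" using Y[OF r] by blast
    have YX: "Y \<subseteq> ?X" using Yb reachable_board_subset[OF r(1)] by blast
    then have finY: "finite Y" by (rule finite_subset) simp
    have terms: "0 \<le> (1 - e i) ^ card (A i \<inter> Y)" for i using e(2)[of i] \<delta> by simp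
    \<comment> \<open>Dropping the booster terms leaves precisely the sum that
      \<open>exists_sparse_hitting_set\<close> requires for \<open>q = \<eta>\<close>.\<close>
    have "(\<Sum>i\<in>cut_index n. (1 - \<eta>) ^ card (cut n i \<inter> Y)) \<le> (\<Sum>i\<in>I. (1 - e i) ^ card (A i \<inter> Y))"
      using \<delta> by (simp add: I_def sum.Plus A_def e_def sum_nonneg)
    then have "(\<Sum>i\<in>cut_index n. (1 - \<eta>) ^ card (cut n i \<inter> Y)) < 1 / 2" using sum by linarith
    then obtain G where G: "G \<subseteq> Y" "\<And>i. i \<in> cut_index n \<Longrightarrow> cut n i \<inter> G \<noteq> {}"
      "real (card G) \<le> 2 * \<eta> * real (card Y)"
      using exists_sparse_hitting_set[of \<eta> "cut_index n" Y "cut n"] \<eta> \<delta> finY by auto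
    have exp: "expander ?V G (n div 4)" using expander_of_cuts G YX by blast
    have "real (card G) + real n \<le> real m"
    proof -
      have "real (card ?X) \<le> real n ^ 2"
      proof -
        have "n * (n - 1) \<le> n ^ 2" by (simp add: power2_eq_square)
        then have "card ?X \<le> n ^ 2" using card_complete_graph_edges[of n] by linarith
        then have "real (card ?X) \<le> real (n ^ 2)" by (rule of_nat_mono)
        then show ?thesis by simp
      qed
      then have "real (card ?X) / (real b + 1) ^ s \<le> real n ^ 2 / (real b + 1) ^ s"
        by (intro divide_right_mono) auto
      then have "2 * \<eta> * real (card Y) \<le> 2 * \<eta> * (real n ^ 2 / (real b + 1) ^ s + 2)"
        using cY \<eta> by (intro mult_left_mono) auto
      then show ?thesis using G(3) m by linarith
    qed
    then have size: "card G + card ?V \<le> m" by simp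
    have "boosters ?V G' \<inter> Y \<noteq> {}"
      if G': "G' \<subseteq> Y" "expander ?V G' (n div 4)" "card G' \<le> m" for G'
    proof
      assume empty: "boosters ?V G' \<inter> Y = {}"
      have "finite G'" using G'(1) finY finite_subset by blast
      moreover have "G' \<noteq> {}"
      proof
        assume "G' = {}"
        moreover have "{0} \<subseteq> ?V" "card {0 :: nat} \<le> n div 4" using n by auto
        ultimately have "2 * card {0 :: nat} < card (neighbourhood {} {0 :: nat} - {0})"
          using G'(2) unfolding expander_def by blast
        then show False by (simp add: neighbourhood_def)
      qed
      ultimately obtain xs where xs: "set xs = G'" "length xs = m" using list_of_length G'(3) by metis
      have "Inr xs \<in> I" using xs G' YX by (auto simp: I_def booster_index_def)
      \<comment> \<open>A booster set missed by \<open>Y\<close> would contribute the term 1, more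
        than the whole sum.\<close>
      then have "(1 - e (Inr xs)) ^ card (A (Inr xs) \<inter> Y) \<le> (\<Sum>i\<in>I. (1 - e i) ^ card (A i \<inter> Y))"
        using terms finI by (intro member_le_sum) auto
      then show False using sum empty xs by (simp add: A_def)
    qed
    then obtain vs where vs: "hamilton_cycle ?V Y vs"
      using hamilton_cycle_of_boosters[of ?V Y "n div 4" m G] graph_on_complete[OF YX] G(1) exp size
      by auto
    then have "cycle_edges vs \<in> snd (HAM n)"
      using hamilton_cycle_mono[OF vs YX] by (auto simp: HAM_def)
    moreover have "cycle_edges vs \<subseteq> board ?X hs" using vs Yb by (auto simp: hamilton_cycle_def)
    moreover have "W \<subseteq> ?X" if "W \<in> snd (HAM n)" for W
      using HAM_subset_board[OF that] by (simp add: HAM_def)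
    ultimately show ?thesis using reachable_winning_sets[OF r(1), of "snd (HAM n)"] by blast
  qed
  with \<sigma> show ?thesis unfolding maker_can_ensure_def by (auto simp: HAM_def)
qed

section \<open>Asymptotics\<close>

text \<open>With \<open>\<eta> = n powr (- 6 * \<theta>)\<close> and
  \<open>p ^ s \<ge> n powr (9 * \<theta> - 1)\<close> the cut exponent is of order at least
  \<open>n powr (3 * \<theta>)\<close>, and \<open>m\<close> is at most of order
  \<open>n powr (1 + 5 * \<theta>)\<close>. The booster exponent, of order at least
  \<open>n powr (1 + 9 * \<theta>)\<close>, therefore exceeds \<open>m * ln n\<close>.\<close>

lemma eventually_maker_can_ensure_HAM:
  assumes "0 < \<theta>" "10 * \<theta> < 1"
  shows "\<forall>\<^sub>F n in at_top. \<forall>b s. 1 \<le> b \<longrightarrow> (real b + 1) ^ s \<le> real n powr (1 - 10 * \<theta>) \<longrightarrow>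
    real n powr (1 - 11 * \<theta>) \<le> (real b + 1) ^ s \<longrightarrow> maker_can_ensure (HAM n) b s"
proof -
  \<comment> \<open>As \<open>2 ^ s \<le> n\<close>, this choice limits the loss
    \<open>(1 - \<delta>) ^ s\<close> over all stages to a factor
    \<open>n powr (- \<theta>)\<close>.\<close>
  define \<delta> :: real where "\<delta> = 1 - 2 powr (- \<theta>)"
  have "2 powr (- \<theta>) < 2 powr (0 :: real)" using assms by (intro powr_less_mono) auto
  then have \<delta>: "0 < \<delta>" "\<delta> < 1" by (auto simp: \<delta>_def)
  have "\<forall>\<^sub>F n :: nat in at_top. real n ^ 4 * exp (- (real n powr (3 * \<theta>) / 4)) < 1 / 4"
    using assms by real_asymp
  moreover have "\<forall>\<^sub>F n :: nat in at_top.
      exp (16 * real n powr (1 + 5 * \<theta>) * ln (real n) - \<delta> * real n powr (1 + 9 * \<theta>) / 32) < 1 / 4"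
    using assms(1) \<delta>(1) by real_asymp
  moreover have "\<forall>\<^sub>F n :: nat in at_top. real n powr (- 6 * \<theta>) \<le> \<delta>"
    using assms(1) \<delta>(1) by real_asymp
  moreover have "\<forall>\<^sub>F n :: nat in at_top. 4 \<le> n" by (rule eventually_ge_at_top)
  ultimately show ?thesis
  proof eventually_elim
    case (elim n)
    define x where "x = real n"
    have x: "4 \<le> x" using elim(4) by (simp add: x_def)
    show ?case
    proof (intro allI impI)
      fix b s :: nat
      assume b: "1 \<le> b" and upper: "(real b + 1) ^ s \<le> real n powr (1 - 10 * \<theta>)"
        and lower: "real n powr (1 - 11 * \<theta>) \<le> (real b + 1) ^ s"
      define T where "T = (real b + 1) ^ s"
      have T: "0 < T" "T \<le> x powr (1 - 10 * \<theta>)" "x powr (1 - 11 * \<theta>) \<le> T"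
        using upper lower by (auto simp: T_def x_def)
      define p where "p = (1 - \<delta>) / (real b + 1)"
      define \<eta> where "\<eta> = x powr (- 6 * \<theta>)"
      have \<eta>: "0 < \<eta>" "\<eta> \<le> \<delta>" using elim(3) x by (auto simp: \<eta>_def x_def)
      have ps: "x powr (9 * \<theta> - 1) \<le> p ^ s"
      proof -
        have "2 ^ s \<le> T" unfolding T_def using b by (intro power_mono) auto
        also have "T \<le> x powr (1 - 10 * \<theta>)" by (rule T)
        also have "\<dots> \<le> x powr 1" using x assms by (intro powr_mono) auto
        finally have s: "2 ^ s \<le> x" using x by simp
        have "x powr (- \<theta>) \<le> (2 ^ s) powr (- \<theta>)" using s assms x by (intro powr_mono2') auto
        also have "\<dots> = (1 - \<delta>) ^ s"
          by (simp add: \<delta>_def powr_power powr_powr mult.commute flip: powr_realpow)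
        finally have 1: "x powr (- \<theta>) \<le> (1 - \<delta>) ^ s" .
        have "x powr (9 * \<theta> - 1) = x powr (- \<theta>) / x powr (1 - 10 * \<theta>)"
          by (simp flip: powr_diff)
        also have "\<dots> \<le> (1 - \<delta>) ^ s / T" using 1 T \<delta> x by (intro frac_le) auto
        also have "\<dots> = p ^ s" by (simp add: p_def T_def power_divide)
        finally show ?thesis .
      qed
      have cuts: "x powr (3 * \<theta>) / 4 \<le> p ^ s * \<eta> * (x / 4)"
      proof -
        have "x powr (3 * \<theta>) = x powr (9 * \<theta> - 1) * \<eta> * x powr 1"
          unfolding \<eta>_def powr_add[symmetric] by simp
        also have "\<dots> = x powr (9 * \<theta> - 1) * (\<eta> * x)" using x by simp
        also have "\<dots> \<le> p ^ s * (\<eta> * x)" using ps \<eta> x by (intro mult_right_mono) auto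
        finally show ?thesis by simp
      qed
      have boost: "\<delta> * x powr (1 + 9 * \<theta>) / 32 \<le> p ^ s * \<delta> * (x ^ 2 / 32)"
      proof -
        have "x powr (1 + 9 * \<theta>) = x powr (9 * \<theta> - 1) * x powr 2" by (simp flip: powr_add)
        also have "\<dots> = x powr (9 * \<theta> - 1) * x ^ 2" using x by simp
        also have "\<dots> \<le> p ^ s * x ^ 2" using ps by (intro mult_right_mono) auto
        finally have "\<delta> * x powr (1 + 9 * \<theta>) \<le> \<delta> * (p ^ s * x ^ 2)" using \<delta> by simp
        then show ?thesis by (simp add: mult_ac)
      qed
      define r where "r = 2 * \<eta> * (x ^ 2 / T + 2) + x"
      define m where "m = nat \<lceil>r\<rceil>"
      have r0: "0 \<le> r" using \<eta> T x by (simp add: r_def)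
      have "r \<le> 2 * x powr (1 + 5 * \<theta>) + 4 + x"
      proof -
        have "x ^ 2 / T \<le> x ^ 2 / x powr (1 - 11 * \<theta>)" using T x by (intro divide_left_mono) auto
        also have "\<dots> = x powr 2 / x powr (1 - 11 * \<theta>)" using x by simp
        also have "\<dots> = x powr (1 + 11 * \<theta>)" by (simp flip: powr_diff)
        finally have "\<eta> * (x ^ 2 / T) \<le> \<eta> * x powr (1 + 11 * \<theta>)"
          using \<eta> by (intro mult_left_mono) auto
        also have "\<dots> = x powr (1 + 5 * \<theta>)"
          unfolding \<eta>_def powr_add[symmetric] by (simp add: add.commute)
        finally have "\<eta> * (x ^ 2 / T) \<le> x powr (1 + 5 * \<theta>)" .
        moreover have "r = 2 * (\<eta> * (x ^ 2 / T)) + 4 * \<eta> + x" by (simp add: r_def distrib_left)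
        ultimately show ?thesis using \<eta> \<delta> by linarith
      qed
      moreover have "x powr 1 \<le> x powr (1 + 5 * \<theta>)" using x assms by (intro powr_mono) auto
      then have "2 * x powr (1 + 5 * \<theta>) + 4 + x \<le> 7 * x powr (1 + 5 * \<theta>) - 1" using x by simp
      ultimately have r: "r \<le> 7 * x powr (1 + 5 * \<theta>) - 1" by linarith
      have m: "r \<le> real m" "real m \<le> 8 * x powr (1 + 5 * \<theta>)"
      proof -
        have "0 \<le> x powr (1 + 5 * \<theta>)" by simp
        moreover have "r \<le> of_int \<lceil>r\<rceil>" "of_int \<lceil>r\<rceil> \<le> r + 1" by linarith+
        moreover have "real m = of_int \<lceil>r\<rceil>" using r0 by (simp add: m_def)
        ultimately show "r \<le> real m" "real m \<le> 8 * x powr (1 + 5 * \<theta>)" using r by linarith+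
      qed
      have "x ^ (2 * m) * exp (- (p ^ s * \<delta> * (x ^ 2 / 32)))
        = exp (2 * real m * ln x - p ^ s * \<delta> * (x ^ 2 / 32))"
      proof -
        have "x ^ (2 * m) = exp (real (2 * m) * ln x)"
          unfolding exp_of_nat_mult using x by simp
        then show ?thesis by (simp flip: exp_add)
      qed
      also have "\<dots> \<le> exp (16 * x powr (1 + 5 * \<theta>) * ln x - \<delta> * x powr (1 + 9 * \<theta>) / 32)"
      proof -
        have "2 * real m * ln x \<le> 16 * x powr (1 + 5 * \<theta>) * ln x"
          using m(2) x by (intro mult_right_mono) auto
        then show ?thesis using boost unfolding exp_le_cancel_iff by (rule diff_mono)
      qed
      also have "\<dots> < 1 / 4" using elim(2) by (simp add: x_def)
      finally have boost': "x ^ (2 * m) * exp (- (p ^ s * \<delta> * (x ^ 2 / 32))) < 1 / 4" .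
      have "x ^ 4 * exp (- (p ^ s * \<eta> * (x / 4))) \<le> x ^ 4 * exp (- (x powr (3 * \<theta>) / 4))"
        using cuts x by (intro mult_left_mono) auto
      also have "\<dots> < 1 / 4" using elim(1) by (simp add: x_def)
      finally have cuts': "x ^ 4 * exp (- (p ^ s * \<eta> * (x / 4))) < 1 / 4" .
      show "maker_can_ensure (HAM n) b s"
        using maker_can_ensure_HAM[OF elim(4) b \<delta> p_def \<eta>, of s m] cuts' boost' m(1)
        by (simp add: x_def r_def T_def)
    qed
  qed
qed

text \<open>The ensured numbers of stages are nonempty by hypothesis and bounded by
  \<open>n\<close>, so \<open>GREATEST\<close> is a true maximum.\<close>

lemma threshold_HAM_bounds:
  assumes "1 \<le> b" "3 \<le> n" "maker_can_ensure (HAM n) b s"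
  shows "s \<le> \<tau> (HAM n) b" "real (\<tau> (HAM n) b) \<le> log (real b + 1) (real n)"
proof -
  have bound: "s' \<le> n" if "maker_can_ensure (HAM n) b s'" for s'
  proof -
    have "real s' < 2 ^ s'" by (rule of_nat_less_two_power)
    also have "\<dots> \<le> (real b + 1) ^ s'" using assms(1) by (intro power_mono) auto
    also have "\<dots> \<le> real n" using maker_can_ensure_HAM_le[OF that assms(1,2)] .
    finally show ?thesis by simp
  qed
  show "s \<le> \<tau> (HAM n) b"
    unfolding threshold_def using assms(3) bound by (rule Greatest_le_nat)
  have "maker_can_ensure (HAM n) b (\<tau> (HAM n) b)"
    unfolding threshold_def using assms(3) bound by (rule GreatestI_nat)
  then have "(real b + 1) powr real (\<tau> (HAM n) b) \<le> real n"
    using maker_can_ensure_HAM_le[OF _ assms(1,2)] by (simp add: powr_realpow)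
  then show "real (\<tau> (HAM n) b) \<le> log (real b + 1) (real n)"
    using assms by (subst le_log_iff) auto
qed

theorem theorem1p1:
  fixes b :: "nat \<Rightarrow> nat"
  assumes "\<And>n. b n \<ge> 1"
    and "subpolynomial (\<lambda>n. real (b n))"
  shows "(\<lambda>n. real (\<tau> (HAM n) (b n))) \<sim>[at_top] (\<lambda>n. log (real (b n) + 1) (real n))"
proof (rule asymp_equivI', rule tendstoI)
  fix e :: real assume e: "0 < e"
  define \<theta> where "\<theta> = min (e / 20) (1 / 20)"
  have \<theta>: "0 < \<theta>" "10 * \<theta> < 1" "11 * \<theta> < e" using e by (auto simp: \<theta>_def)
  have "(\<lambda>n. real (b n)) \<in> o(\<lambda>n. real n powr \<theta>)"
    using assms(2) \<theta>(1) by (simp add: subpolynomial_def)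
  \<comment> \<open>The factor \<open>1 / 2\<close> turns into
    \<open>b n + 1 \<le> n powr \<theta>\<close>, since
    \<open>b n + 1 \<le> 2 * b n\<close>.\<close>
  then have "\<forall>\<^sub>F n in at_top. norm (real (b n)) \<le> 1 / 2 * norm (real n powr \<theta>)"
    by (rule landau_o.smallD) simp
  then show "\<forall>\<^sub>F n in at_top. dist (real (\<tau> (HAM n) (b n)) / log (real (b n) + 1) (real n)) 1 < e"
    using eventually_maker_can_ensure_HAM[OF \<theta>(1,2)] eventually_ge_at_top[of 3]
  proof eventually_elim
    case (elim n)
    define c where "c = real (b n) + 1"
    define L where "L = log c (real n)"
    define s where "s = nat \<lfloor>(1 - 10 * \<theta>) * L\<rfloor>"
    have b1: "1 \<le> real (b n)" using assms(1)[of n] by simp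
    then have c: "2 \<le> c" "c \<le> real n powr \<theta>" using elim(1) by (auto simp: c_def)
    have cL: "c powr L = real n" using c elim(3) by (simp add: L_def)
    \<comment> \<open>This is where subpolynomiality enters: rounding \<open>s\<close> down loses at
      most \<open>1 \<le> \<theta> * L\<close>, which turns \<open>10 * \<theta>\<close> into
      \<open>11 * \<theta>\<close>.\<close>
    have "1 \<le> \<theta> * L"
    proof -
      have "c powr 1 \<le> c powr (\<theta> * L)" using c cL by (simp add: mult.commute flip: powr_powr)
      then show ?thesis using c by (subst (asm) powr_le_cancel_iff) auto
    qed
    then have "0 < \<theta> * L" by linarith
    then have L: "0 < L" using \<theta>(1) by (simp add: zero_less_mult_iff)
    have s: "real s \<le> (1 - 10 * \<theta>) * L" "(1 - 10 * \<theta>) * L - 1 \<le> real s"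
      using L \<theta>(2) by (auto simp: s_def)
    have cs: "c ^ s = c powr real s" using c by (simp add: powr_realpow)
    have "c ^ s \<le> c powr (L * (1 - 10 * \<theta>))"
      using s(1) c unfolding cs by (intro powr_mono) (auto simp: mult.commute)
    then have 1: "c ^ s \<le> real n powr (1 - 10 * \<theta>)" by (simp add: cL flip: powr_powr)
    have "c powr (L * (1 - 11 * \<theta>)) \<le> c powr real s"
      using s(2) c \<open>1 \<le> \<theta> * L\<close> by (intro powr_mono) (auto simp: algebra_simps)
    then have 2: "real n powr (1 - 11 * \<theta>) \<le> c ^ s" by (simp add: cL cs flip: powr_powr)
    have "maker_can_ensure (HAM n) (b n) s"
      using elim(2) assms(1) 1 2 by (auto simp: c_def)
    note bounds = threshold_HAM_bounds[OF assms(1) elim(3) this]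
    let ?t = "real (\<tau> (HAM n) (b n))"
    have "?t \<le> L" using bounds(2) by (simp add: L_def c_def)
    moreover have "(1 - 11 * \<theta>) * L \<le> ?t"
      using bounds(1) s(2) \<open>1 \<le> \<theta> * L\<close> by (simp add: algebra_simps)
    ultimately have "?t / L \<le> 1" "1 - 11 * \<theta> \<le> ?t / L" using L by (auto simp: field_simps)
    then have "dist (?t / L) 1 < e" using \<theta>(3) by (simp add: dist_real_def)
    then show ?case by (simp add: L_def c_def)
  qed
qed

end
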